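(* Let $X_1,\dots,X_n$ be i.i.d. random vectors from a distribution $D$ over $\mathbb{R}^d$ with mean $\mu$ and finite covariance $\Sigma$, and let $2^{-O(n)}\le\delta<1$. Given $\{X_i\}_{i=1}^n$ and $\delta$, any constant-factor approximation algorithm for the spectral sample reweighing problem can be used (applied to the bucket means) to compute an estimate $\widehat\mu$ such that, with probability at least $1-\delta$, $$\|\widehat\mu-\mu\|\le C\left(\sqrt{\frac{\mathrm{Tr}(\Sigma)}{n}}+\sqrt{\frac{\|\Sigma\|\log(1/\delta)}{n}}\right),$$ where $C$ is a constant depending only on the approximation factor.
   Context: $\mathcal{W}_{n,\epsilon}=\{w\in\mathbb{R}^n:w_i\ge0,\ \sum_iw_i=1,\ w_i\le\frac1{(1-\epsilon)n}\}$. $(\alpha,\epsilon)$-spectral sample reweighing ($\epsilon\in(0,1/2)$, $\alpha\ge1$): the input is points $x_1,\dots,x_m\in\mathbb{R}^d$ and $\lambda\in\mathbb{R}$, with the promise that there exist $\nu\in\mathbb{R}^d$ and $w\in\mathcal{W}_{m,\epsilon}$ with $\sum_i w_i(x_i-\nu)(x_i-\nu)^\top\preceq\lambda I$; the output must be $w'\in\mathcal{W}_{m,3\epsilon}$ and $\nu'\in\mathbb{R}^d$ with $\sum_i w'_i(x_i-\nu')(x_i-\nu')^\top\preceq\alpha\lambda I$. A constant-factor approximation algorithm achieves this with $\alpha=O(1)$ (for a fixed small constant $\epsilon$). Bucket means: partition the samples into $k=\lceil800\log(1/\delta)\rceil$ disjoint equal-size groups and average each group. *)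

theory Defs
  imports "HOL-Probability.Probability"
begin

text \<open>
  The constant of the theorem must not depend on the dimension, so the dimension \<open>d\<close> is a
  natural number and not a type: a vector of \<open>\<real>\<^sup>d\<close> is a function \<open>nat \<Rightarrow> real\<close> of which only the
  values on \<open>{..<d}\<close> matter, a \<open>d \<times> d\<close> matrix is a function \<open>nat \<Rightarrow> nat \<Rightarrow> real\<close>, and a family of
  \<open>m\<close> points is a function whose values on \<open>{..<m}\<close> matter. The Euclidean norm of \<open>v\<close> is
  \<open>L2_set v {..<d}\<close>.
\<close>

type_synonym vect = "nat \<Rightarrow> real"
type_synonym matr = "nat \<Rightarrow> nat \<Rightarrow> real"

definition Rd :: "nat \<Rightarrow> vect measure" where
  "Rd d = PiM {..<d} (\<lambda>_. borel)"

definition psd :: "nat \<Rightarrow> matr \<Rightarrow> bool" where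
  "psd d S \<longleftrightarrow> (\<forall>v :: vect. 0 \<le> (\<Sum>a<d. \<Sum>b<d. v a * S a b * v b))"

definition loewner_le :: "nat \<Rightarrow> matr \<Rightarrow> matr \<Rightarrow> bool" where
  "loewner_le d S T \<longleftrightarrow> psd d (\<lambda>a b. T a b - S a b)"

definition scalar_matr :: "real \<Rightarrow> matr" where
  "scalar_matr c = (\<lambda>a b. if a = b then c else 0)"

definition trace_matr :: "nat \<Rightarrow> matr \<Rightarrow> real" where
  "trace_matr d S = (\<Sum>a<d. S a a)"

definition op_norm :: "nat \<Rightarrow> matr \<Rightarrow> real" where
  "op_norm d S = (SUP v \<in> {v :: vect. L2_set v {..<d} \<le> 1}. L2_set (\<lambda>a. \<Sum>b<d. S a b * v b) {..<d})"

definition mean_vec :: "vect measure \<Rightarrow> vect" where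
  "mean_vec D = (\<lambda>a. \<integral>x. x a \<partial>D)"

definition cov_matr :: "vect measure \<Rightarrow> matr" where
  "cov_matr D = (\<lambda>a b. \<integral>x. (x a - mean_vec D a) * (x b - mean_vec D b) \<partial>D)"

definition finite_cov_distribution :: "nat \<Rightarrow> vect measure \<Rightarrow> bool" where
  "finite_cov_distribution d D \<longleftrightarrow>
     prob_space D \<and> sets D = sets (Rd d) \<and> (\<forall>a<d. integrable D (\<lambda>x. (x a)\<^sup>2))"

definition weights :: "nat \<Rightarrow> real \<Rightarrow> (nat \<Rightarrow> real) set" where
  "weights m \<epsilon> = {w. (\<forall>i<m. 0 \<le> w i \<and> w i \<le> 1 / ((1 - \<epsilon>) * real m)) \<and> (\<Sum>i<m. w i) = 1}"

definition scatter :: "nat \<Rightarrow> (nat \<Rightarrow> real) \<Rightarrow> (nat \<Rightarrow> vect) \<Rightarrow> vect \<Rightarrow> matr" where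
  "scatter m w x \<nu> = (\<lambda>a b. \<Sum>i<m. w i * ((x i a - \<nu> a) * (x i b - \<nu> b)))"

definition spectral_center ::
  "nat \<Rightarrow> nat \<Rightarrow> (nat \<Rightarrow> vect) \<Rightarrow> real \<Rightarrow> real \<Rightarrow> (nat \<Rightarrow> real) \<Rightarrow> vect \<Rightarrow> bool" where
  "spectral_center d m x \<epsilon> lam w \<nu> \<longleftrightarrow>
     w \<in> weights m \<epsilon> \<and> loewner_le d (scatter m w x \<nu>) (scalar_matr lam)"

text \<open>
  An algorithm receives the dimension, the number of points, the points and \<open>\<lambda>\<close>, and returns
  \<open>(w', \<nu>')\<close>. Nothing is required of its answer when the promise fails.
\<close>

type_synonym reweighing_algorithm =
  "nat \<Rightarrow> nat \<Rightarrow> (nat \<Rightarrow> vect) \<Rightarrow> real \<Rightarrow> (nat \<Rightarrow> real) \<times> vect"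

definition solution_accepted ::
  "real \<Rightarrow> real \<Rightarrow> reweighing_algorithm \<Rightarrow> nat \<Rightarrow> nat \<Rightarrow> (nat \<Rightarrow> vect) \<Rightarrow> real \<Rightarrow> bool" where
  "solution_accepted \<alpha> \<epsilon> A d m x lam \<longleftrightarrow>
     spectral_center d m x (3 * \<epsilon>) (\<alpha> * lam) (fst (A d m x lam)) (snd (A d m x lam))"

definition solves_spectral_reweighing :: "real \<Rightarrow> real \<Rightarrow> reweighing_algorithm \<Rightarrow> bool" where
  "solves_spectral_reweighing \<alpha> \<epsilon> A \<longleftrightarrow>
     (\<forall>d m x lam. (\<exists>w \<nu>. spectral_center d m x \<epsilon> lam w \<nu>) \<longrightarrow> solution_accepted \<alpha> \<epsilon> A d m x lam)"

definition bucket_count :: "real \<Rightarrow> nat" where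
  "bucket_count \<delta> = nat \<lceil>800 * ln (1 / \<delta>)\<rceil>"

text \<open>
  Groups of \<open>n div k\<close> consecutive samples; the remaining \<open>n mod k\<close> samples are not used.
\<close>

definition bucket_means :: "nat \<Rightarrow> nat \<Rightarrow> (nat \<Rightarrow> vect) \<Rightarrow> nat \<Rightarrow> vect" where
  "bucket_means n k X = (\<lambda>j a. (\<Sum>i\<in>{j * (n div k)..<(j + 1) * (n div k)}. X i a) / real (n div k))"

text \<open>
  The algorithm needs a value of \<open>\<lambda>\<close>, but the estimator sees neither \<open>\<mu>\<close> nor \<open>\<Sigma>\<close>. It therefore
  searches for \<open>\<lambda>\<close>, using that an answer of the algorithm can be checked. The search starts at the
  value \<open>initial_level\<close>, for which uniform weights and the first point fulfil the promise, and
  halves \<open>\<lambda>\<close> until the next answer is wrong, so that the promise is known to fail there; the centre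
  returned for the last value before that is the estimate.

  The halving can fail to stop only when some point occurs at least \<open>(1 - 3\<epsilon>)m\<close> times among the
  \<open>m\<close> points. That point, with uniform weights on its occurrences, is then a solution for
  every \<open>\<lambda> \<ge> 0\<close>, and it is returned directly.
\<close>

definition multiplicity_at :: "nat \<Rightarrow> nat \<Rightarrow> (nat \<Rightarrow> vect) \<Rightarrow> nat \<Rightarrow> nat" where
  "multiplicity_at d m x i = card {j. j < m \<and> (\<forall>a<d. x j a = x i a)}"

definition initial_level :: "nat \<Rightarrow> nat \<Rightarrow> (nat \<Rightarrow> vect) \<Rightarrow> real" where
  "initial_level d m x = (\<Sum>i<m. (L2_set (\<lambda>a. x i a - x 0 a) {..<d})\<^sup>2)"

definition searched_center ::
  "real \<Rightarrow> real \<Rightarrow> reweighing_algorithm \<Rightarrow> nat \<Rightarrow> nat \<Rightarrow> (nat \<Rightarrow> vect) \<Rightarrow> vect" where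
  "searched_center \<alpha> \<epsilon> A d m x =
     (if \<exists>i<m. (1 - 3 * \<epsilon>) * real m \<le> real (multiplicity_at d m x i)
      then x (LEAST i. i < m \<and> (1 - 3 * \<epsilon>) * real m \<le> real (multiplicity_at d m x i))
      else let J = (LEAST j. \<not> solution_accepted \<alpha> \<epsilon> A d m x (initial_level d m x / 2 ^ (j + 1)))
           in snd (A d m x (initial_level d m x / 2 ^ J)))"

definition mean_estimate ::
  "real \<Rightarrow> real \<Rightarrow> reweighing_algorithm \<Rightarrow> nat \<Rightarrow> nat \<Rightarrow> real \<Rightarrow> (nat \<Rightarrow> vect) \<Rightarrow> vect" where
  "mean_estimate \<alpha> \<epsilon> A d n \<delta> X =
     searched_center \<alpha> \<epsilon> A d (bucket_count \<delta>) (bucket_means n (bucket_count \<delta>) X)"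

end

theory Submission
  imports Defs
begin

text \<open>
  Let \<open>Y\<^sub>j\<close> be the deviation of the \<open>j\<close>-th bucket mean from \<open>\<mu>\<close>. A PAC-Bayes argument with Gaussian
  directions shows that with probability \<open>1 - \<delta>\<close>, for every unit vector \<open>v\<close> simultaneously, at most
  \<open>\<epsilon>k/32\<close> of the projections \<open>\<langle>v, Y\<^sub>j\<rangle>\<close> exceed a radius of the order of the claimed error. Rounding
  by random signs extends this from unit vectors to mixtures \<open>\<Sum> p\<^sub>v \<langle>v, Y\<^sub>j\<rangle>\<^sup>2\<close>, with \<open>\<epsilon>k\<close> exceptions,
  and the minimax theorem then yields one weight vector that is good for all directions, so the
  promise holds at a level \<open>\<lambda>\<close> of the order of the squared error. The search returns a centre for at
  most twice that level, and two centres whose weights share mass \<open>1 - 4\<epsilon>\<close> must be close.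
\<close>

subsection \<open>Spectral centres and the search\<close>

text \<open>A union bound over a net of directions would put the dimension into the failure
  probability. Averaging over Gaussian directions of covariance I/k avoids this: the entropy cost of
  a shift by a unit vector is k/2 in every dimension. The price is a variance enlarged by 1/k times
  the trace. As a bucket mean has covariance about k/n times \<Sigma>, the two parts become
  ||\<Sigma>|| k/n and Tr(\<Sigma>)/n, and with k of order log(1/\<delta>) these are the squares of
  the two terms of the bound. The buckets to be discarded depend on the direction, whereas the
  promise needs one weight vector. Exchanging the quantifiers by minimax demands an answer to every
  mixture of directions, that is, to a matrix of trace at most 1 instead of rank one. Sign rounding
  turns such a mixture back into a single direction; it costs a factor 32 in the number of
  exceptions, which explains \<epsilon>k/32, and a factor 64 in the squared radius.\<close>

definition dotp :: "nat \<Rightarrow> vect \<Rightarrow> vect \<Rightarrow> real" where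
  "dotp d u v = (\<Sum>a<d. u a * v a)"

lemma dotp_self_nonneg [simp]: "0 \<le> dotp d v v"
  by (simp add: dotp_def sum_nonneg)

lemma L2_set_eq_sqrt_dotp: "L2_set v {..<d} = sqrt (dotp d v v)"
  by (simp add: L2_set_def dotp_def power2_eq_square)

lemma dotp_add_left: "dotp d (\<lambda>a. u a + v a) w = dotp d u w + dotp d v w"
  by (simp add: dotp_def sum.distrib algebra_simps)

lemma dotp_diff_left: "dotp d (\<lambda>a. u a - v a) w = dotp d u w - dotp d v w"
  by (simp add: dotp_def sum_subtractf algebra_simps)

lemma dotp_add_right: "dotp d w (\<lambda>a. u a + v a) = dotp d w u + dotp d w v"
  by (simp add: dotp_def sum.distrib algebra_simps)

lemma dotp_diff_right: "dotp d w (\<lambda>a. u a - v a) = dotp d w u - dotp d w v"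
  by (simp add: dotp_def sum_subtractf algebra_simps)

lemma dotp_scale_left: "dotp d (\<lambda>a. c * u a) w = c * dotp d u w"
  by (simp add: dotp_def sum_distrib_left algebra_simps)

lemma dotp_scale_right: "dotp d w (\<lambda>a. c * u a) = c * dotp d w u"
  by (simp add: dotp_def sum_distrib_left algebra_simps)

lemma dotp_uminus_left: "dotp d (\<lambda>a. - u a) w = - dotp d u w"
  by (simp add: dotp_def sum_negf)

lemma dotp_cauchy_schwarz: "(dotp d u v)\<^sup>2 \<le> dotp d u u * dotp d v v"
proof -
  have "\<bar>dotp d u v\<bar> \<le> (\<Sum>a<d. \<bar>u a\<bar> * \<bar>v a\<bar>)"
    unfolding dotp_def by (rule order_trans[OF sum_abs]) (simp add: abs_mult)
  also have "\<dots> \<le> L2_set u {..<d} * L2_set v {..<d}"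
    by (rule L2_set_mult_ineq)
  also have "\<dots> = sqrt (dotp d u u * dotp d v v)"
    by (simp add: L2_set_eq_sqrt_dotp real_sqrt_mult)
  finally have "\<bar>dotp d u v\<bar>\<^sup>2 \<le> (sqrt (dotp d u u * dotp d v v))\<^sup>2"
    by (intro power_mono) auto
  then show ?thesis by simp
qed

lemma dotp_sq_expand: "(dotp d v y)\<^sup>2 = (\<Sum>a<d. \<Sum>b<d. v a * (y a * y b) * v b)"
  by (simp add: dotp_def power2_eq_square sum_product algebra_simps)

text \<open>From here on the Loewner order is used only through its quadratic form, so that matrices
  give way to weighted sums of squared projections.\<close>

lemma spectral_center_iff:
  "spectral_center d m x \<epsilon> lam w \<nu> \<longleftrightarrow>
     w \<in> weights m \<epsilon> \<and>
     (\<forall>v. (\<Sum>i<m. w i * (dotp d v (\<lambda>a. x i a - \<nu> a))\<^sup>2) \<le> lam * dotp d v v)"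
proof -
  have "(\<Sum>a<d. \<Sum>b<d. v a * (scalar_matr lam a b - scatter m w x \<nu> a b) * v b) =
      lam * dotp d v v - (\<Sum>i<m. w i * (dotp d v (\<lambda>a. x i a - \<nu> a))\<^sup>2)" for v
  proof -
    have "(\<Sum>a<d. \<Sum>b<d. v a * scalar_matr lam a b * v b) = (\<Sum>a<d. lam * (v a * v a))"
    proof (rule sum.cong[OF refl])
      fix a assume "a \<in> {..<d}"
      have "(\<Sum>b<d. v a * scalar_matr lam a b * v b) = (\<Sum>b<d. if a = b then lam * (v a * v b) else 0)"
        by (intro sum.cong) (auto simp: scalar_matr_def)
      with \<open>a \<in> {..<d}\<close> show "(\<Sum>b<d. v a * scalar_matr lam a b * v b) = lam * (v a * v a)"
        by simp
    qed
    then have 1: "(\<Sum>a<d. \<Sum>b<d. v a * scalar_matr lam a b * v b) = lam * dotp d v v"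
      by (simp add: dotp_def sum_distrib_left)
    have "(\<Sum>i<m. w i * (dotp d v (\<lambda>a. x i a - \<nu> a))\<^sup>2) =
        (\<Sum>i<m. \<Sum>a<d. \<Sum>b<d. v a * (w i * ((x i a - \<nu> a) * (x i b - \<nu> b))) * v b)"
      by (simp add: dotp_sq_expand sum_distrib_left algebra_simps)
    also have "\<dots> = (\<Sum>a<d. \<Sum>i<m. \<Sum>b<d. v a * (w i * ((x i a - \<nu> a) * (x i b - \<nu> b))) * v b)"
      by (rule sum.swap)
    also have "\<dots> = (\<Sum>a<d. \<Sum>b<d. \<Sum>i<m. v a * (w i * ((x i a - \<nu> a) * (x i b - \<nu> b))) * v b)"
      by (intro sum.cong refl sum.swap)
    also have "\<dots> = (\<Sum>a<d. \<Sum>b<d. v a * scatter m w x \<nu> a b * v b)"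
      by (simp add: scatter_def sum_distrib_left sum_distrib_right)
    finally have 2: "(\<Sum>i<m. w i * (dotp d v (\<lambda>a. x i a - \<nu> a))\<^sup>2) =
        (\<Sum>a<d. \<Sum>b<d. v a * scatter m w x \<nu> a b * v b)" .
    show ?thesis
      by (simp add: 1[symmetric] 2 sum_subtractf[symmetric] algebra_simps)
  qed
  then show ?thesis
    by (simp add: spectral_center_def loewner_le_def psd_def)
qed

lemma spectral_center_mono:
  assumes "spectral_center d m x \<epsilon> lam w \<nu>" and "lam \<le> lam'"
  shows "spectral_center d m x \<epsilon> lam' w \<nu>"
  using assms unfolding spectral_center_iff
  by (meson dotp_self_nonneg mult_right_mono order_trans)

text \<open>
  The scaled weights \<open>(1 - \<epsilon>) w\<close> and \<open>(1 - 3\<epsilon>) w'\<close> are both at most \<open>1/m\<close>, so their pointwise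
  minimum keeps mass at least \<open>1 - 4\<epsilon>\<close>; on that common mass both scatter bounds apply.
\<close>

lemma spectral_centers_close:
  assumes eps: "0 < \<epsilon>" "\<epsilon> < 1 / 4" and m: "0 < m"
    and c: "spectral_center d m x \<epsilon> l w \<nu>" "0 \<le> l"
    and c': "spectral_center d m x (3 * \<epsilon>) l' w' \<nu>'" "0 \<le> l'"
  shows "(1 - 4 * \<epsilon>) * (L2_set (\<lambda>a. \<nu>' a - \<nu> a) {..<d})\<^sup>2 \<le> 2 * (l + l')"
proof -
  define u where "u = (\<lambda>a. \<nu>' a - \<nu> a)"
  define N where "N = dotp d u u"
  define t where "t = (\<lambda>i. min ((1 - \<epsilon>) * w i) ((1 - 3 * \<epsilon>) * w' i))"
  have w: "0 \<le> w i" "(1 - \<epsilon>) * w i \<le> 1 / m" and w': "0 \<le> w' i" "(1 - 3 * \<epsilon>) * w' i \<le> 1 / m" if "i < m" for i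
    using c(1) c'(1) that eps m unfolding spectral_center_iff weights_def by (auto simp: field_simps)
  have sw: "(\<Sum>i<m. w i) = 1" "(\<Sum>i<m. w' i) = 1"
    using c(1) c'(1) unfolding spectral_center_iff weights_def by auto
  have t0: "0 \<le> t i" "t i \<le> w i" "t i \<le> w' i" if "i < m" for i
  proof -
    have "(1 - \<epsilon>) * w i \<le> 1 * w i" "(1 - 3 * \<epsilon>) * w' i \<le> 1 * w' i"
      using w(1)[OF that] w'(1)[OF that] eps by (intro mult_right_mono; simp)+
    then show "0 \<le> t i" "t i \<le> w i" "t i \<le> w' i"
      using w(1)[OF that] w'(1)[OF that] eps by (auto simp: t_def)
  qed
  \<comment> \<open>A minimum is the sum minus the maximum, and here the maximum is at most
    1/m.\<close>
  have "1 - 4 * \<epsilon> = (\<Sum>i<m. (1 - \<epsilon>) * w i + (1 - 3 * \<epsilon>) * w' i - 1 / m)"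
    using m sw by (simp add: sum.distrib sum_subtractf sum_distrib_left[symmetric])
  also have "\<dots> \<le> (\<Sum>i<m. t i)"
    using w(2) w'(2) by (intro sum_mono) (auto simp: t_def min_def algebra_simps; force)
  finally have T: "1 - 4 * \<epsilon> \<le> (\<Sum>i<m. t i)" .
  \<comment> \<open>Both scatter bounds are tested in the direction \<open>u\<close> of the
    difference itself. There the two projections of each point differ by exactly \<open>N\<close>,
    so \<open>N\<close> squared stands on the left, \<open>N\<close> on the right, and one factor
    cancels at the end.\<close>
  have "(1 - 4 * \<epsilon>) * N\<^sup>2 \<le> (\<Sum>i<m. t i) * N\<^sup>2"
    using T by (intro mult_right_mono) auto
  also have "\<dots> = (\<Sum>i<m. t i * N\<^sup>2)"
    by (simp add: sum_distrib_right)
  also have "\<dots> \<le> (\<Sum>i<m. 2 * (w i * (dotp d u (\<lambda>a. x i a - \<nu> a))\<^sup>2) + 2 * (w' i * (dotp d u (\<lambda>a. x i a - \<nu>' a))\<^sup>2))"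
  proof (rule sum_mono)
    fix i assume "i \<in> {..<m}"
    then have i: "i < m" by simp
    define p q where "p = dotp d u (\<lambda>a. x i a - \<nu> a)" and "q = dotp d u (\<lambda>a. x i a - \<nu>' a)"
    have "N = p - q"
      unfolding N_def p_def q_def by (simp add: u_def dotp_diff_right)
    then have "N\<^sup>2 \<le> 2 * p\<^sup>2 + 2 * q\<^sup>2"
      using zero_le_power2[of "p + q"] by (simp add: power2_sum power2_diff)
    then have "t i * N\<^sup>2 \<le> t i * (2 * p\<^sup>2 + 2 * q\<^sup>2)"
      using t0(1)[OF i] by (rule mult_left_mono)
    also have "\<dots> \<le> 2 * (w i * p\<^sup>2) + 2 * (w' i * q\<^sup>2)"
      using mult_right_mono[OF t0(2)[OF i], of "p\<^sup>2"] mult_right_mono[OF t0(3)[OF i], of "q\<^sup>2"]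
      by (simp add: algebra_simps)
    finally show "t i * N\<^sup>2 \<le> 2 * (w i * (dotp d u (\<lambda>a. x i a - \<nu> a))\<^sup>2) + 2 * (w' i * (dotp d u (\<lambda>a. x i a - \<nu>' a))\<^sup>2)"
      by (simp add: p_def q_def)
  qed
  also have "\<dots> = 2 * (\<Sum>i<m. w i * (dotp d u (\<lambda>a. x i a - \<nu> a))\<^sup>2) + 2 * (\<Sum>i<m. w' i * (dotp d u (\<lambda>a. x i a - \<nu>' a))\<^sup>2)"
    by (simp add: sum.distrib sum_distrib_left)
  also have "\<dots> \<le> 2 * (l * N) + 2 * (l' * N)"
    using c(1) c'(1) unfolding spectral_center_iff N_def by (intro add_mono mult_left_mono) auto
  finally have *: "((1 - 4 * \<epsilon>) * N) * N \<le> (2 * (l + l')) * N"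
    by (simp add: power2_eq_square algebra_simps)
  have N0: "0 \<le> N" by (simp add: N_def)
  have "(1 - 4 * \<epsilon>) * N \<le> 2 * (l + l')"
  proof (cases "N = 0")
    case False
    with N0 * show ?thesis by simp
  qed (use c(2) c'(2) in simp)
  then show ?thesis
    using N0 by (simp add: L2_set_eq_sqrt_dotp N_def u_def)
qed

section \<open>Levels met by the search\<close>

lemma uniform_weights: "0 < m \<Longrightarrow> 0 \<le> \<epsilon> \<Longrightarrow> \<epsilon> < 1 \<Longrightarrow> (\<lambda>i. 1 / real m) \<in> weights m \<epsilon>"
  by (auto simp: weights_def field_simps)

text \<open>Serves two supports: the occurrences of a repeated point, and the indices that remain
  after a few exceptional ones are deleted.\<close>

lemma uniform_on_subset_weights:
  assumes "S \<subseteq> {..<m}" and "(1 - \<epsilon>) * real m \<le> real (card S)" and "0 < m" and "\<epsilon> < 1"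
  shows "(\<lambda>i. if i \<in> S then 1 / real (card S) else 0) \<in> weights m \<epsilon>"
proof -
  have p: "0 < (1 - \<epsilon>) * real m" using assms by simp
  have fin: "finite S" using assms(1) finite_subset by blast
  have "(\<Sum>i<m. if i \<in> S then 1 / real (card S) else 0) = (\<Sum>i\<in>{..<m} \<inter> S. 1 / real (card S))"
    by (simp add: sum.If_cases)
  also have "{..<m} \<inter> S = S" using assms(1) by auto
  also have "(\<Sum>i\<in>S. 1 / real (card S)) = 1" using p assms(2) by simp
  finally show ?thesis
    using p assms(2) unfolding weights_def
    by (auto intro!: divide_left_mono mult_pos_pos)
qed

text \<open>Makes the search start at an accepted level, so that the level just before the first
  rejection is always accepted. Cauchy-Schwarz suffices, with the factor 1/m dropped.\<close>

lemma initial_level_center: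
  assumes "0 < m" "0 < \<epsilon>" "\<epsilon> < 1"
  shows "spectral_center d m x \<epsilon> (initial_level d m x) (\<lambda>i. 1 / real m) (x 0)"
  unfolding spectral_center_iff
proof (intro conjI allI)
  show "(\<lambda>i. 1 / real m) \<in> weights m \<epsilon>" using assms by (intro uniform_weights) auto
  fix v
  have "(\<Sum>i<m. 1 / real m * (dotp d v (\<lambda>a. x i a - x 0 a))\<^sup>2)
      \<le> (\<Sum>i<m. 1 * (dotp d v v * dotp d (\<lambda>a. x i a - x 0 a) (\<lambda>a. x i a - x 0 a)))"
    using assms by (intro sum_mono mult_mono dotp_cauchy_schwarz) auto
  also have "\<dots> = initial_level d m x * dotp d v v"
    by (simp add: initial_level_def L2_set_eq_sqrt_dotp sum_distrib_left mult.commute)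
  finally show "(\<Sum>i<m. 1 / real m * (dotp d v (\<lambda>a. x i a - x 0 a))\<^sup>2) \<le> initial_level d m x * dotp d v v" .
qed

text \<open>
  Points within half the minimal separation of the centre coincide, so by the multiplicity bound
  their weights sum to less than 1; the other points carry little weight by Markov's inequality.
\<close>

lemma spectral_level_lower_bound:
  assumes "0 < m" "\<epsilon> < 1"
    and nomult: "\<And>i. i < m \<Longrightarrow> real (multiplicity_at d m x i) < (1 - \<epsilon>) * real m"
  shows "\<exists>l0>0. \<forall>l w \<nu>. spectral_center d m x \<epsilon> l w \<nu> \<longrightarrow> l0 \<le> l"
proof -
  define D where "D = (\<lambda>i j. dotp d (\<lambda>a. x i a - x j a) (\<lambda>a. x i a - x j a))"
  have D_eq: "\<forall>a<d. x j a = x i a" if "D j i \<le> 0" for i j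
  proof -
    have "(\<Sum>a<d. (x j a - x i a) * (x j a - x i a)) = 0"
      using that unfolding D_def dotp_def by (intro antisym sum_nonneg) auto
    then show ?thesis by (subst (asm) sum_nonneg_eq_0_iff) auto
  qed
  \<comment> \<open>The inserted 1 keeps the set nonempty, so that its minimum is meaningful even
    when no two points differ.\<close>
  define G where "G = insert 1 {D i j | i j. i < m \<and> j < m \<and> 0 < D i j}"
  have finG: "finite G"
  proof -
    have "{D i j | i j. i < m \<and> j < m \<and> 0 < D i j} \<subseteq> (\<lambda>(i, j). D i j) ` ({..<m} \<times> {..<m})" by auto
    then show ?thesis unfolding G_def by (meson finite_SigmaI finite_imageI finite_insert finite_lessThan finite_subset)
  qed
  define g where "g = Min G"
  have g0: "0 < g" unfolding g_def using finG by (subst Min_gr_iff) (auto simp: G_def)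
  have gD: "g \<le> D i j" if "i < m" "j < m" "0 < D i j" for i j
    unfolding g_def using finG that by (intro Min_le) (auto simp: G_def)
  define K where "K = (1 - \<epsilon>) * real m"
  have K0: "0 < K" using assms by (simp add: K_def)
  define M where "M = Max ((\<lambda>i. real (multiplicity_at d m x i)) ` {..<m})"
  have M: "real (multiplicity_at d m x i) \<le> M" if "i < m" for i
    unfolding M_def using that by (intro Max_ge) auto
  have MK: "M < K"
    unfolding M_def K_def using assms(1) nomult by (subst Max_less_iff) auto
  have M0: "0 \<le> M"
    using M[of 0] assms(1) by (meson of_nat_0_le_iff order_trans)
  \<comment> \<open>Points at squared distance below g/4 from the centre carry mass at most M/K, so
    mass at least 1 - M/K lies farther out. On the other hand, testing on the coordinate vectors
    bounds the weighted sum of squared distances by d times the level. Writing d + 1 avoids division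
    by zero.\<close>
  define l0 where "l0 = (1 - M / K) * g / (4 * (real d + 1))"
  have "0 < l0" unfolding l0_def using MK K0 g0 by simp
  moreover have "l0 \<le> l" if c: "spectral_center d m x \<epsilon> l w \<nu>" for l w \<nu>
  proof -
    have w: "0 \<le> w i" "w i \<le> 1 / K" if "i < m" for i
      using c that unfolding spectral_center_iff weights_def K_def by auto
    have sw: "(\<Sum>i<m. w i) = 1"
      using c unfolding spectral_center_iff weights_def by auto
    define e where "e = (\<lambda>i. dotp d (\<lambda>a. x i a - \<nu> a) (\<lambda>a. x i a - \<nu> a))"
    have coord: "(\<Sum>i<m. w i * (x i a - \<nu> a)\<^sup>2) \<le> l" if "a < d" for a
    proof -
      define v where "v = (\<lambda>b. if b = a then 1 else 0 :: real)"
      have v: "dotp d v y = y a" for y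
      proof -
        have "dotp d v y = (\<Sum>b<d. if b = a then y b else 0)"
          unfolding dotp_def v_def by (intro sum.cong) auto
        then show ?thesis using that by simp
      qed
      have "(\<Sum>i<m. w i * (dotp d v (\<lambda>a. x i a - \<nu> a))\<^sup>2) \<le> l * dotp d v v"
        using c unfolding spectral_center_iff by blast
      then show ?thesis unfolding v by (simp add: v_def)
    qed
    have "(\<Sum>i<m. w i * e i) = (\<Sum>a<d. \<Sum>i<m. w i * (x i a - \<nu> a)\<^sup>2)"
      unfolding e_def dotp_def by (subst sum.swap) (simp add: sum_distrib_left power2_eq_square)
    also have "\<dots> \<le> real d * l"
      using sum_mono[of "{..<d}", OF coord] by simp
    finally have se: "(\<Sum>i<m. w i * e i) \<le> real d * l" .
    have l_nonneg: "0 \<le> l" if "0 < d"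
      using coord[OF that] sum_nonneg[of "{..<m}" "\<lambda>i. w i * (x i 0 - \<nu> 0)\<^sup>2"] w(1) by fastforce
    define S where "S = {i. i < m \<and> e i < g / 4}"
    have close: "\<forall>a<d. x j a = x i a" if "i \<in> S" "j \<in> S" for i j
    proof -
      have "D j i \<le> 2 * e j + 2 * e i"
      proof -
        have "D j i \<le> (\<Sum>a<d. 2 * ((x j a - \<nu> a) * (x j a - \<nu> a)) + 2 * ((x i a - \<nu> a) * (x i a - \<nu> a)))"
          unfolding D_def dotp_def
        proof (rule sum_mono)
          fix a
          show "(x j a - x i a) * (x j a - x i a) \<le> 2 * ((x j a - \<nu> a) * (x j a - \<nu> a)) + 2 * ((x i a - \<nu> a) * (x i a - \<nu> a))"
            using zero_le_square[of "(x j a - \<nu> a) + (x i a - \<nu> a)"] by (simp add: algebra_simps)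
        qed
        then show ?thesis by (simp add: e_def dotp_def sum.distrib sum_distrib_left)
      qed
      also have "\<dots> < g" using that unfolding S_def by auto
      finally have "\<not> 0 < D j i" using gD[of j i] that unfolding S_def by auto
      then show ?thesis by (intro D_eq) simp
    qed
    have cS: "real (card S) \<le> M"
    proof (cases "S = {}")
      case False
      then obtain i where i: "i \<in> S" by auto
      have "S \<subseteq> {j. j < m \<and> (\<forall>a<d. x j a = x i a)}"
        using close[OF i] unfolding S_def by auto
      then have "card S \<le> multiplicity_at d m x i"
        unfolding multiplicity_at_def by (intro card_mono) auto
      also have "real (multiplicity_at d m x i) \<le> M" using i M unfolding S_def by auto
      finally show ?thesis by simp
    qed (use M0 in simp)
    have "1 = (\<Sum>i<m. w i)" using sw by simp
    also have "\<dots> \<le> (\<Sum>i<m. (if i \<in> S then 1 / K else 0) + 4 / g * (w i * e i))"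
    proof (rule sum_mono)
      fix i assume "i \<in> {..<m}"
      then have i: "i < m" by simp
      have e0: "0 \<le> e i" by (simp add: e_def)
      show "w i \<le> (if i \<in> S then 1 / K else 0) + 4 / g * (w i * e i)"
      proof (cases "i \<in> S")
        case True
        have "0 \<le> 4 / g * (w i * e i)" using w(1)[OF i] e0 g0 by simp
        with True w(2)[OF i] show ?thesis by simp
      next
        case False
        then have "1 \<le> 4 / g * e i" using i g0 unfolding S_def by (auto simp: field_simps)
        then have "w i * 1 \<le> w i * (4 / g * e i)" using w(1)[OF i] by (rule mult_left_mono)
        with False show ?thesis by (simp add: mult_ac)
      qed
    qed
    also have "\<dots> = real (card S) / K + 4 / g * (\<Sum>i<m. w i * e i)"
    proof -
      have "(\<Sum>i<m. if i \<in> S then 1 / K else 0) = (\<Sum>i\<in>{..<m} \<inter> S. 1 / K)"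
        by (simp add: sum.If_cases)
      also have "{..<m} \<inter> S = S" unfolding S_def by auto
      finally show ?thesis by (simp add: sum.distrib sum_distrib_left)
    qed
    also have "\<dots> \<le> M / K + 4 / g * (real d * l)"
      using cS K0 g0 se by (intro add_mono divide_right_mono mult_left_mono) auto
    finally have *: "(1 - M / K) * g \<le> 4 * (real d * l)"
      using g0 by (simp add: field_simps)
    have "0 < (1 - M / K) * g" using MK K0 g0 by simp
    with * have "0 < d" by (cases "d = 0") auto
    with l_nonneg * have "(1 - M / K) * g \<le> l * (4 * (real d + 1))" by (simp add: algebra_simps)
    then show ?thesis unfolding l0_def by (simp add: divide_le_eq)
  qed
  ultimately show ?thesis by blast
qed

text \<open>A rejection proves that the promise fails at that level, which therefore cannot exceed
  \<open>l\<close>, since centres persist at larger levels. The last accepted level is thus at most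
  2l. Its answer can be trusted even if the promise fails there, because acceptance itself certifies
  the scatter bound. Comparing levels \<open>l\<close> and 2\<alpha>l gives the factor 2 +
  4\<alpha>.\<close>

lemma searched_center_close:
  assumes eps: "0 < \<epsilon>" "\<epsilon> < 1 / 4" and al: "1 \<le> \<alpha>" and m: "0 < m"
    and A: "solves_spectral_reweighing \<alpha> \<epsilon> A"
    and c: "spectral_center d m x \<epsilon> l w \<nu>" "0 \<le> l"
  shows "(1 - 4 * \<epsilon>) * (L2_set (\<lambda>a. searched_center \<alpha> \<epsilon> A d m x a - \<nu> a) {..<d})\<^sup>2 \<le> (2 + 4 * \<alpha>) * l"
proof (cases "\<exists>i<m. (1 - 3 * \<epsilon>) * real m \<le> real (multiplicity_at d m x i)")
  case True
  define i where "i = (LEAST i. i < m \<and> (1 - 3 * \<epsilon>) * real m \<le> real (multiplicity_at d m x i))"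
  have i: "i < m" "(1 - 3 * \<epsilon>) * real m \<le> real (multiplicity_at d m x i)"
    using LeastI_ex[OF True] unfolding i_def by auto
  have sc: "searched_center \<alpha> \<epsilon> A d m x = x i"
    using True unfolding searched_center_def i_def by simp
  define S where "S = {j. j < m \<and> (\<forall>a<d. x j a = x i a)}"
  have "spectral_center d m x (3 * \<epsilon>) 0 (\<lambda>j. if j \<in> S then 1 / real (card S) else 0) (x i)"
    unfolding spectral_center_iff
  proof (intro conjI allI)
    show "(\<lambda>j. if j \<in> S then 1 / real (card S) else 0) \<in> weights m (3 * \<epsilon>)"
      using i(2) m eps by (intro uniform_on_subset_weights) (auto simp: S_def multiplicity_at_def)
    fix v
    have "dotp d v (\<lambda>a. x j a - x i a) = 0" if "j \<in> S" for j
      using that by (simp add: dotp_def S_def)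
    then show "(\<Sum>j<m. (if j \<in> S then 1 / real (card S) else 0) * (dotp d v (\<lambda>a. x j a - x i a))\<^sup>2) \<le> 0 * dotp d v v"
      by (intro order.trans[OF sum_nonpos]) auto
  qed
  from spectral_centers_close[OF eps m c this]
  have "(1 - 4 * \<epsilon>) * (L2_set (\<lambda>a. x i a - \<nu> a) {..<d})\<^sup>2 \<le> 2 * l" by simp
  also have "\<dots> \<le> (2 + 4 * \<alpha>) * l" using c(2) al by (intro mult_right_mono) auto
  finally show ?thesis by (simp add: sc)
next
  case False
  define L where "L = initial_level d m x"
  have L0: "0 \<le> L" by (simp add: L_def initial_level_def sum_nonneg)
  have prom: "solution_accepted \<alpha> \<epsilon> A d m x lam" if "spectral_center d m x \<epsilon> lam w \<nu>" for lam w \<nu>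
    using A that unfolding solves_spectral_reweighing_def by blast
  \<comment> \<open>Every accepted answer is a genuine centre for 3\<epsilon> at \<alpha> times the
    queried level. Without a heavy point such levels are bounded away from 0, so the halving must
    stop.\<close>
  have ex: "\<exists>j. \<not> solution_accepted \<alpha> \<epsilon> A d m x (L / 2 ^ (j + 1))"
  proof -
    obtain l0 where l0: "0 < l0" "\<And>l w \<nu>. spectral_center d m x (3 * \<epsilon>) l w \<nu> \<Longrightarrow> l0 \<le> l"
      using spectral_level_lower_bound[of m "3 * \<epsilon>" d x] m eps False by force
    have "(\<lambda>j. \<alpha> * (L / 2 ^ (j + 1))) \<longlonglongrightarrow> 0"
    proof -
      have "(\<lambda>j. (\<alpha> * L / 2) * (1 / 2) ^ j) \<longlonglongrightarrow> (\<alpha> * L / 2) * 0"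
        by (intro tendsto_intros LIMSEQ_power_zero) auto
      then show ?thesis by (simp add: power_divide field_simps)
    qed
    then have "eventually (\<lambda>j. \<alpha> * (L / 2 ^ (j + 1)) < l0) sequentially"
      using l0(1) by (rule order_tendstoD)
    then obtain j where "\<alpha> * (L / 2 ^ (j + 1)) < l0"
      by (auto simp: eventually_sequentially)
    then show ?thesis
      unfolding solution_accepted_def by (metis l0(2) not_le)
  qed
  define J where "J = (LEAST j. \<not> solution_accepted \<alpha> \<epsilon> A d m x (L / 2 ^ (j + 1)))"
  have sc: "searched_center \<alpha> \<epsilon> A d m x = snd (A d m x (L / 2 ^ J))"
    using False unfolding searched_center_def J_def L_def by (simp only: if_False Let_def)
  have rej: "\<not> solution_accepted \<alpha> \<epsilon> A d m x (L / 2 ^ (J + 1))"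
    unfolding J_def by (rule LeastI_ex[OF ex])
  have acc: "solution_accepted \<alpha> \<epsilon> A d m x (L / 2 ^ J)"
  proof (cases J)
    case 0
    then show ?thesis
      using prom[OF initial_level_center[OF m, of \<epsilon> d x]] eps by (simp add: L_def)
  next
    case (Suc j)
    then have "j < J" by simp
    from not_less_Least[OF this[unfolded J_def]] Suc show ?thesis by simp
  qed
  have "L / 2 ^ (J + 1) \<le> l"
  proof (rule ccontr)
    assume "\<not> L / 2 ^ (J + 1) \<le> l"
    then have "spectral_center d m x \<epsilon> (L / 2 ^ (J + 1)) w \<nu>"
      by (intro spectral_center_mono[OF c(1)]) simp
    with prom rej show False by blast
  qed
  then have lev: "L / 2 ^ J \<le> 2 * l" by (simp add: field_simps)
  have lev0: "0 \<le> L / 2 ^ J" using L0 by simp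
  have "0 \<le> \<alpha> * (L / 2 ^ J)" using lev0 al by (intro mult_nonneg_nonneg) auto
  from spectral_centers_close[OF eps m c acc[unfolded solution_accepted_def] this]
  have "(1 - 4 * \<epsilon>) * (L2_set (\<lambda>a. searched_center \<alpha> \<epsilon> A d m x a - \<nu> a) {..<d})\<^sup>2 \<le> 2 * (l + \<alpha> * (L / 2 ^ J))"
    by (simp add: sc)
  also have "\<dots> \<le> 2 * (l + \<alpha> * (2 * l))"
    using lev al by (intro mult_left_mono add_left_mono) auto
  finally show ?thesis by (simp add: algebra_simps)
qed

subsection \<open>From directions to weights: minimax and sign rounding\<close>

definition mix :: "real \<Rightarrow> (nat \<Rightarrow> real) \<Rightarrow> (nat \<Rightarrow> real) \<Rightarrow> nat \<Rightarrow> real" where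
  "mix t w w' = (\<lambda>i. (1 - t) * w i + t * w' i)"

text \<open>The pair (f, g) maps \<open>K\<close> onto a compact convex set in the plane. If that
  set misses the quadrant of points with both coordinates at most \<open>c\<close>, a line separates
  them strictly, and its normal, once normalised, is a convex combination that exceeds
  \<open>c\<close> on all of \<open>K\<close>.\<close>

lemma minimax_two:
  fixes f g :: "(nat \<Rightarrow> real) \<Rightarrow> real"
  assumes K: "compact K" "K \<noteq> {}"
    and mixK: "\<And>t w w'. \<lbrakk>w \<in> K; w' \<in> K; 0 \<le> t; t \<le> 1\<rbrakk> \<Longrightarrow> mix t w w' \<in> K"
    and cont: "continuous_on UNIV f" "continuous_on UNIV g"
    and aff: "\<And>t w w'. f (mix t w w') = (1 - t) * f w + t * f w'"
      "\<And>t w w'. g (mix t w w') = (1 - t) * g w + t * g w'"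
    and comb: "\<And>t. \<lbrakk>0 \<le> t; t \<le> 1\<rbrakk> \<Longrightarrow> \<exists>w\<in>K. (1 - t) * f w + t * g w \<le> c"
  shows "\<exists>w\<in>K. f w \<le> c \<and> g w \<le> c"
proof (rule ccontr)
  assume no: "\<not> ?thesis"
  define S where "S = (\<lambda>w. (f w, g w)) ` K"
  define T where "T = {..c} \<times> {..c}"
  have "convex S"
    unfolding convex_alt
  proof (intro ballI allI impI)
    fix x y u assume "x \<in> S" "y \<in> S" and u: "0 \<le> u \<and> (u::real) \<le> 1"
    then obtain w w' where w: "w \<in> K" "w' \<in> K" "x = (f w, g w)" "y = (f w', g w')"
      unfolding S_def by blast
    then have "(1 - u) *\<^sub>R x + u *\<^sub>R y = (f (mix u w w'), g (mix u w w'))"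
      by (simp add: aff)
    moreover have "mix u w w' \<in> K" using w u mixK by blast
    ultimately show "(1 - u) *\<^sub>R x + u *\<^sub>R y \<in> S" unfolding S_def by blast
  qed
  moreover have "compact S"
    unfolding S_def using cont K(1)
    by (intro compact_continuous_image continuous_on_Pair) (auto intro: continuous_on_subset)
  moreover have "S \<noteq> {}" using K(2) by (simp add: S_def)
  moreover have "convex T" unfolding T_def by (intro convex_Times) auto
  moreover have "closed T" unfolding T_def by (intro closed_Times) auto
  moreover have "S \<inter> T = {}" using no unfolding S_def T_def by auto
  ultimately obtain a b where sep: "\<forall>x\<in>S. inner a x < b" "\<forall>x\<in>T. b < inner a x"
    using separating_hyperplane_compact_closed[of S T] by blast
  obtain a1 a2 where a: "a = (a1, a2)" by (cases a)
  have T1: "b < a1 * (c - s) + a2 * (c - r)" if "0 \<le> s" "0 \<le> r" for s r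
    using sep(2)[rule_format, of "(c - s, c - r)"] that by (simp add: T_def a)
  have S1: "a1 * f w + a2 * g w < b" if "w \<in> K" for w
    using sep(1)[rule_format, of "(f w, g w)"] that by (auto simp: S_def a)
  have bc: "b < (a1 + a2) * c" using T1[of 0 0] by (simp add: algebra_simps)
  \<comment> \<open>The quadrant is unbounded downwards: with a positive coefficient one could move
    along it until the functional equals \<open>b\<close>, against strict separation.\<close>
  have a1: "a1 \<le> 0"
  proof (rule ccontr)
    assume "\<not> a1 \<le> 0"
    then obtain s where "0 \<le> s" "a1 * s = (a1 + a2) * c - b"
      using bc that[of "((a1 + a2) * c - b) / a1"] by simp
    with T1[of s 0] show False by (simp add: algebra_simps)
  qed
  have a2: "a2 \<le> 0"
  proof (rule ccontr)
    assume "\<not> a2 \<le> 0"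
    then obtain s where "0 \<le> s" "a2 * s = (a1 + a2) * c - b"
      using bc that[of "((a1 + a2) * c - b) / a2"] by simp
    with T1[of 0 s] show False by (simp add: algebra_simps)
  qed
  obtain w0 where "w0 \<in> K" using K(2) by blast
  have neg: "a1 + a2 < 0"
  proof (rule ccontr)
    assume "\<not> a1 + a2 < 0"
    with a1 a2 have "a1 = 0" "a2 = 0" by auto
    with bc S1[OF \<open>w0 \<in> K\<close>] show False by simp
  qed
  define t where "t = a2 / (a1 + a2)"
  have t: "0 \<le> t" "t \<le> 1" using a1 a2 neg unfolding t_def by (auto simp: field_simps)
  then obtain w where w: "w \<in> K" "(1 - t) * f w + t * g w \<le> c" using comb by blast
  have "(a1 + a2) * ((1 - t) * f w + t * g w) = a1 * f w + a2 * g w"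
  proof -
    have "(a1 + a2) * t = a2" "(a1 + a2) * (1 - t) = a1" using neg by (auto simp: t_def field_simps)
    then show ?thesis by (metis distrib_left mult.assoc)
  qed
  moreover have "(a1 + a2) * c \<le> (a1 + a2) * ((1 - t) * f w + t * g w)"
    using w(2) neg by (intro mult_left_mono_neg) auto
  ultimately show False using S1[OF w(1)] bc by linarith
qed

text \<open>Induction on the functionals keeps the separation argument in the plane. Cutting
  \<open>K\<close> by the sublevel set of the new functional preserves compactness and convexity,
  and the hypothesis on mixtures survives the cut by the two-function case, applied to a mixture of
  the old functionals and the new one. This is why \<open>K\<close> varies in the induction.\<close>

lemma minimax_finite:
  fixes l :: "'j \<Rightarrow> (nat \<Rightarrow> real) \<Rightarrow> real"
  assumes "finite J" and "compact K" "K \<noteq> {}"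
    and "\<And>t w w'. \<lbrakk>w \<in> K; w' \<in> K; 0 \<le> t; t \<le> 1\<rbrakk> \<Longrightarrow> mix t w w' \<in> K"
    and cont: "\<And>j. continuous_on UNIV (l j)"
    and aff: "\<And>j t w w'. l j (mix t w w') = (1 - t) * l j w + t * l j w'"
    and "\<And>p. \<lbrakk>\<And>j. 0 \<le> p j; sum p J = 1\<rbrakk> \<Longrightarrow> \<exists>w\<in>K. (\<Sum>j\<in>J. p j * l j w) \<le> c"
  shows "\<exists>w\<in>K. \<forall>j\<in>J. l j w \<le> c"
  using assms(1-4,7)
proof (induction J arbitrary: K rule: finite_induct)
  case empty
  then show ?case by auto
next
  case (insert j J)
  define K' where "K' = K \<inter> {w. l j w \<le> c}"
  have cl: "closed {w. l j w \<le> c}"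
    using cont by (intro closed_Collect_le) auto
  have cK': "compact K'"
    unfolding K'_def using insert.prems(1) cl by (rule compact_Int_closed)
  have mixK': "mix t w w' \<in> K'" if "w \<in> K'" "w' \<in> K'" "0 \<le> t" "t \<le> 1" for t w w'
  proof -
    have "(1 - t) * l j w + t * l j w' \<le> (1 - t) * c + t * c"
      using that by (intro add_mono mult_left_mono) (auto simp: K'_def)
    also have "\<dots> = c" by (simp add: algebra_simps)
    finally show ?thesis using that insert.prems(3) by (auto simp: K'_def aff)
  qed
  have comb: "\<exists>w\<in>K'. (\<Sum>i\<in>J. p i * l i w) \<le> c" if p: "\<And>i. 0 \<le> p i" "sum p J = 1" for p
  proof -
    define f where "f = (\<lambda>w. \<Sum>i\<in>J. p i * l i w)"
    have "\<exists>w\<in>K. f w \<le> c \<and> l j w \<le> c"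
    proof (rule minimax_two[OF insert.prems(1,2,3)])
      show "continuous_on UNIV f" unfolding f_def using cont by (intro continuous_intros)
      show "f (mix t w w') = (1 - t) * f w + t * f w'" for t w w'
        unfolding f_def aff sum_distrib_left sum.distrib[symmetric] by (intro sum.cong) (auto simp: algebra_simps)
      fix t :: real assume t: "0 \<le> t" "t \<le> 1"
      define q where "q = (\<lambda>i. if i = j then t else (1 - t) * p i)"
      have qJ: "(\<Sum>i\<in>J. q i * h i) = (1 - t) * (\<Sum>i\<in>J. p i * h i)" for h
        unfolding sum_distrib_left using insert.hyps(2) by (intro sum.cong) (auto simp: q_def)
      have q0: "0 \<le> q i" for i using p t by (auto simp: q_def)
      have "sum q (insert j J) = 1"
        using insert.hyps qJ[of "\<lambda>_. 1"] p by (simp add: q_def)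
      from insert.prems(4)[OF q0 this] obtain w where "w \<in> K" "(\<Sum>i\<in>insert j J. q i * l i w) \<le> c" by blast
      then show "\<exists>w\<in>K. (1 - t) * f w + t * l j w \<le> c"
        using insert.hyps qJ[of "\<lambda>i. l i w"] by (intro bexI[of _ w]) (auto simp: f_def q_def)
    qed (use cont aff in auto)
    then show ?thesis by (auto simp: K'_def f_def)
  qed
  \<comment> \<open>The point mass on the new functional is an admissible mixture.\<close>
  have "K' \<noteq> {}"
  proof -
    define p where "p = (\<lambda>i. if i = j then 1 else 0 :: real)"
    have "0 \<le> p i" for i by (simp add: p_def)
    moreover have pJ: "(\<Sum>i\<in>J. p i * h i) = 0" for h
      using insert.hyps by (intro sum.neutral) (auto simp: p_def)
    moreover have "sum p (insert j J) = 1"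
      using insert.hyps pJ[of "\<lambda>_. 1"] by (simp add: p_def)
    ultimately obtain w where "w \<in> K" "(\<Sum>i\<in>insert j J. p i * l i w) \<le> c"
      using insert.prems(4) by blast
    then show ?thesis using insert.hyps pJ[of "\<lambda>i. l i w"] by (auto simp: K'_def p_def)
  qed
  have "\<exists>w\<in>K'. \<forall>i\<in>J. l i w \<le> c"
    by (rule insert.IH[OF cK' \<open>K' \<noteq> {}\<close>]) (use mixK' comb in blast)+
  then show ?case unfolding K'_def by blast
qed

text \<open>\<open>weights\<close> leaves all values from \<open>m\<close> on free and so is not
  compact in the product topology; fixing them to 0 allows the use of Tychonoff's theorem.\<close>

definition weights_ext :: "nat \<Rightarrow> real \<Rightarrow> (nat \<Rightarrow> real) set" where
  "weights_ext m \<epsilon> = weights m \<epsilon> \<inter> {w. \<forall>i\<ge>m. w i = 0}"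

lemma compact_weights_ext: "compact (weights_ext m \<epsilon>)"
proof -
  define S where "S = (\<lambda>i. if i < m then {0 .. 1 / ((1 - \<epsilon>) * real m)} else {0})"
  have "compactin (product_topology (\<lambda>i. euclidean) UNIV) (PiE UNIV S)"
    by (subst compactin_PiE) (auto simp: S_def)
  then have c: "compact (PiE UNIV S)"
    by (simp add: euclidean_product_topology)
  have cl: "closed {w :: nat \<Rightarrow> real. (\<Sum>i<m. w i) = 1}"
    by (intro closed_Collect_eq continuous_intros continuous_on_product_coordinates)
  have "weights_ext m \<epsilon> = PiE UNIV S \<inter> {w. (\<Sum>i<m. w i) = 1}"
    by (auto simp: weights_ext_def weights_def S_def PiE_iff split: if_splits; metis not_le)
  then show ?thesis using c cl by (simp add: compact_Int_closed)
qed

lemma mix_weights_ext: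
  assumes "w \<in> weights_ext m \<epsilon>" "w' \<in> weights_ext m \<epsilon>" "0 \<le> t" "t \<le> 1"
  shows "mix t w w' \<in> weights_ext m \<epsilon>"
proof -
  define c where "c = 1 / ((1 - \<epsilon>) * real m)"
  have "0 \<le> (1 - t) * w i + t * w' i \<and> (1 - t) * w i + t * w' i \<le> c" if "i < m" for i
  proof -
    have w: "0 \<le> w i" "w i \<le> c" "0 \<le> w' i" "w' i \<le> c"
      using that assms unfolding weights_ext_def weights_def c_def by auto
    then have "(1 - t) * w i + t * w' i \<le> (1 - t) * c + t * c"
      using assms by (intro add_mono mult_left_mono) auto
    moreover have "(1 - t) * c + t * c = c" by (simp add: algebra_simps)
    moreover have "0 \<le> (1 - t) * w i + t * w' i" using w assms by simp
    ultimately show ?thesis by linarith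
  qed
  moreover have "(\<Sum>i<m. (1 - t) * w i + t * w' i) = 1"
    using assms by (simp add: weights_ext_def weights_def sum.distrib sum_distrib_left[symmetric])
  ultimately show ?thesis
    using assms by (auto simp: weights_ext_def weights_def mix_def c_def)
qed

text \<open>
  With \<open>X = \<langle>g, y\<rangle>\<^sup>2\<close> for \<open>g = \<Sum> \<plusminus> u\<^sub>j\<close> with random signs, \<open>sign_potential s A\<close> is a lower bound for the
  conditional expectation of \<open>(X - 1/2)(6 - X)\<close> when the part of \<open>\<langle>g, y\<rangle>\<close> fixed so far is \<open>s\<close> and
  the remaining variance is \<open>A\<close>; it uses the Khinchine bound \<open>3 A\<^sup>2\<close> for the fourth moment.
\<close>

definition sign_potential :: "real \<Rightarrow> real \<Rightarrow> real" where
  "sign_potential s A = 13 / 2 * (s^2 + A) - 3 - (s^4 + 6 * s^2 * A + 3 * A^2)"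

text \<open>Averaging over one more sign does not lower the potential: the exact fourth moment of
  the new term is a^4, while the Khinchine term charges 3a^4 for it. The difference, taken twice, is
  the 4a^4 of the proof.\<close>

lemma sign_potential_split:
  "2 * sign_potential s (a^2 + A) \<le> sign_potential (s + a) A + sign_potential (s - a) A"
proof -
  have "sign_potential (s + a) A + sign_potential (s - a) A - 2 * sign_potential s (a^2 + A) = 4 * a^4"
    unfolding sign_potential_def by algebra
  moreover have "0 \<le> 4 * a^4" by simp
  ultimately show ?thesis by linarith
qed

lemma sign_potential_zero: "sign_potential s 0 = (s^2 - 1 / 2) * (6 - s^2)"
  by (simp add: sign_potential_def field_simps power2_eq_square power4_eq_xxxx)

text \<open>The method of conditional expectations: the signs are fixed one at a time, and at least
  one of the two choices does not lower the penalised potential. The penalty is carried along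
  because one and the same \<open>g\<close> must have many large projections and a small norm; by
  the parallelogram law it averages exactly.\<close>

lemma sign_choice_exists:
  fixes u :: "'j \<Rightarrow> vect" and y :: "'i \<Rightarrow> vect"
  assumes "finite J"
  shows "\<exists>g. (\<Sum>i\<in>B. sign_potential (dotp d g0 (y i)) (\<Sum>j\<in>J. (dotp d (u j) (y i))\<^sup>2))
        - c * (dotp d g0 g0 + (\<Sum>j\<in>J. dotp d (u j) (u j)))
      \<le> (\<Sum>i\<in>B. sign_potential (dotp d g (y i)) 0) - c * dotp d g g"
  using assms
proof (induction J arbitrary: g0 rule: finite_induct)
  case empty
  show ?case by (auto intro: exI[of _ g0])
next
  case (insert k J)
  define A where "A = (\<lambda>i. \<Sum>j\<in>J. (dotp d (u j) (y i))\<^sup>2)"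
  define R where "R = (\<Sum>j\<in>J. dotp d (u j) (u j))"
  define F where "F = (\<lambda>g. (\<Sum>i\<in>B. sign_potential (dotp d g (y i)) (A i)) - c * (dotp d g g + R))"
  define gp gm where "gp = (\<lambda>a. g0 a + u k a)" and "gm = (\<lambda>a. g0 a - u k a)"
  have sq: "dotp d gp gp + dotp d gm gm = 2 * (dotp d g0 g0 + dotp d (u k) (u k))"
    unfolding gp_def gm_def
    by (simp add: dotp_add_left dotp_diff_left dotp_add_right dotp_diff_right)
  have pot: "2 * (\<Sum>i\<in>B. sign_potential (dotp d g0 (y i)) ((dotp d (u k) (y i))\<^sup>2 + A i)) \<le>
     (\<Sum>i\<in>B. sign_potential (dotp d gp (y i)) (A i)) + (\<Sum>i\<in>B. sign_potential (dotp d gm (y i)) (A i))"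
    unfolding sum_distrib_left sum.distrib[symmetric] gp_def gm_def dotp_add_left dotp_diff_left
    by (intro sum_mono sign_potential_split)
  define H where "H = (\<Sum>i\<in>B. sign_potential (dotp d g0 (y i)) ((dotp d (u k) (y i))\<^sup>2 + A i))
      - c * (dotp d g0 g0 + (dotp d (u k) (u k) + R))"
  have "F gp + F gm = (\<Sum>i\<in>B. sign_potential (dotp d gp (y i)) (A i)) + (\<Sum>i\<in>B. sign_potential (dotp d gm (y i)) (A i))
      - c * ((dotp d gp gp + dotp d gm gm) + 2 * R)"
    unfolding F_def by (simp only: distrib_left mult_2)
  also have "\<dots> \<ge> 2 * H"
    using pot unfolding sq H_def by (simp add: algebra_simps)
  finally have "H \<le> F gp \<or> H \<le> F gm" by linarith
  then have "\<exists>g1. H \<le> F g1" by blast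
  then obtain g1 where g1: "H \<le> F g1" by blast
  obtain g where "F g1 \<le> (\<Sum>i\<in>B. sign_potential (dotp d g (y i)) 0) - c * dotp d g g"
    using insert.IH[of g1] unfolding F_def A_def R_def by blast
  with g1 insert.hyps show ?case
    unfolding H_def A_def R_def by (intro exI[of _ g]) simp
qed

text \<open>A Paley-Zygmund argument. The polynomial (X - 1/2)(6 - X) is positive only for 1/2 < X <
  6, so a large total over \<open>B\<close> forces many indices with X at least 1/2. The same
  inequality bounds the norm of \<open>g\<close>, which is then rescaled into the unit ball.\<close>

lemma direction_from_mixture:
  fixes y :: "'i \<Rightarrow> vect" and V :: "vect set"
  assumes V: "finite V" "\<And>v. v \<in> V \<Longrightarrow> dotp d v v \<le> 1"
    and p: "\<And>v. 0 \<le> p v" "sum p V = 1" and r: "0 \<le> r" and B: "finite B"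
    and big: "\<And>i. i \<in> B \<Longrightarrow> 64 * r < (\<Sum>v\<in>V. p v * (dotp d v (y i))\<^sup>2)"
  shows "\<exists>g. dotp d g g \<le> 1 \<and> card B \<le> 32 * card {i\<in>B. r < (dotp d g (y i))\<^sup>2}"
proof (cases "B = {}")
  case True
  then show ?thesis by (intro exI[of _ "\<lambda>_. 0"]) (simp add: dotp_def)
next
  case False
  define q where "q = (\<lambda>i. \<Sum>v\<in>V. p v * (dotp d v (y i))\<^sup>2)"
  have q: "0 < q i" if "i \<in> B" for i using big[OF that] r by (simp add: q_def)
  \<comment> \<open>With these scalings the signed sum of the \<open>u v\<close> has projection of
    variance exactly 1 on every \<open>z i\<close>, and expected squared norm at most 1.\<close>
  define z where "z = (\<lambda>i a. 1 / sqrt (q i) * y i a)"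
  define u where "u = (\<lambda>v a. sqrt (p v) * v a :: real)"
  define N where "N = real (card B)"
  have N: "0 < N" using False B by (simp add: N_def card_gt_0_iff)
  obtain g where g: "(\<Sum>i\<in>B. sign_potential (dotp d (\<lambda>_. 0) (z i)) (\<Sum>v\<in>V. (dotp d (u v) (z i))\<^sup>2))
        - N / 4 * (dotp d (\<lambda>_. 0) (\<lambda>_. 0) + (\<Sum>v\<in>V. dotp d (u v) (u v)))
      \<le> (\<Sum>i\<in>B. sign_potential (dotp d g (z i)) 0) - N / 4 * dotp d g g"
    using sign_choice_exists[OF V(1)] by blast
  have one: "(\<Sum>v\<in>V. (dotp d (u v) (z i))\<^sup>2) = 1" if "i \<in> B" for i
  proof -
    have "(\<Sum>v\<in>V. (dotp d (u v) (z i))\<^sup>2) = (\<Sum>v\<in>V. 1 / q i * (p v * (dotp d v (y i))\<^sup>2))"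
      unfolding u_def z_def dotp_scale_left dotp_scale_right using q[OF that] p(1)
      by (intro sum.cong) (auto simp: power_mult_distrib power_divide)
    also have "\<dots> = 1 / q i * q i" unfolding q_def sum_distrib_left ..
    finally show ?thesis using q[OF that] by simp
  qed
  have "(\<Sum>v\<in>V. dotp d (u v) (u v)) = (\<Sum>v\<in>V. p v * dotp d v v)"
    using p(1) by (intro sum.cong) (auto simp: u_def dotp_scale_left dotp_scale_right)
  also have "\<dots> \<le> (\<Sum>v\<in>V. p v * 1)" using V p by (intro sum_mono mult_left_mono) auto
  also have "\<dots> = 1" using p by simp
  finally have U: "(\<Sum>v\<in>V. dotp d (u v) (u v)) \<le> 1" .
  have z0: "dotp d (\<lambda>_. 0) w = 0" for w by (simp add: dotp_def)
  \<comment> \<open>Each index starts with potential 13/2 - 3 - 3 = 1/2. The penalty coefficient N/4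
    spends half of the total N/2 and leaves N/4.\<close>
  have "(\<Sum>i\<in>B. sign_potential (dotp d (\<lambda>_. 0) (z i)) (\<Sum>v\<in>V. (dotp d (u v) (z i))\<^sup>2)) = N / 2"
    using one by (simp add: z0 sign_potential_def N_def)
  moreover have "N / 4 * (dotp d (\<lambda>_. 0) (\<lambda>_. 0) + (\<Sum>v\<in>V. dotp d (u v) (u v))) \<le> N / 4"
    using U N by (simp add: z0)
  ultimately have main: "N / 4 + N / 4 * dotp d g g \<le> (\<Sum>i\<in>B. sign_potential (dotp d g (z i)) 0)"
    using g by linarith
  define C where "C = {i\<in>B. 1 / 2 \<le> (dotp d g (z i))\<^sup>2}"
  have le: "sign_potential s 0 \<le> (if 1 / 2 \<le> s\<^sup>2 then 121 / 16 else 0)" for s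
  proof (cases "1 / 2 \<le> s\<^sup>2")
    case True
    have "(s\<^sup>2 - 1 / 2) * (6 - s\<^sup>2) = 121 / 16 - (s\<^sup>2 - 13 / 4)\<^sup>2" by (simp add: power2_eq_square field_simps)
    with True show ?thesis unfolding sign_potential_zero by simp
  next
    case False
    then show ?thesis unfolding sign_potential_zero by (simp add: mult_nonpos_nonneg)
  qed
  have "(\<Sum>i\<in>B. sign_potential (dotp d g (z i)) 0) \<le> (\<Sum>i\<in>B. if 1 / 2 \<le> (dotp d g (z i))\<^sup>2 then 121 / 16 else 0)"
    by (intro sum_mono le)
  also have "\<dots> = 121 / 16 * real (card C)"
    using B by (simp add: sum.If_cases C_def Int_def)
  \<comment> \<open>The value 121/16 is the maximum of (X - 1/2)(6 - X), attained at X = 13/4. This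
    one inequality yields both constants: the squared norm is at most 121/4 - 1, and
    \<open>C\<close> contains at least 4/121 of the indices; 32 covers both.\<close>
  finally have C: "N / 4 + N / 4 * dotp d g g \<le> 121 / 16 * real (card C)" using main by linarith
  have "card C \<le> card B" using B by (intro card_mono) (auto simp: C_def)
  then have "121 / 16 * real (card C) \<le> 121 / 16 * N" by (simp add: N_def)
  with C have "N / 4 * (1 + dotp d g g) \<le> N / 4 * (121 / 4)" by (simp add: algebra_simps)
  with N have G: "dotp d g g \<le> 32" by simp
  have "0 \<le> N / 4 * dotp d g g" using N by simp
  with C have CB: "N \<le> 32 * real (card C)" by simp
  \<comment> \<open>The threshold 1/2 and the rescaling by 32 together lose the factor 64 in the
    hypothesis \<open>big\<close>.\<close>
  define h where "h = (\<lambda>a. 1 / sqrt 32 * g a)"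
  have "dotp d h h \<le> 1"
    unfolding h_def dotp_scale_left dotp_scale_right using G by (simp del: real_sqrt_mult)
  moreover have "C \<subseteq> {i\<in>B. r < (dotp d h (y i))\<^sup>2}"
  proof
    fix i assume "i \<in> C"
    then have i: "i \<in> B" and "1 / 2 \<le> (dotp d g (z i))\<^sup>2" by (auto simp: C_def)
    moreover have "(dotp d g (z i))\<^sup>2 = (dotp d g (y i))\<^sup>2 / q i"
      unfolding z_def dotp_scale_right using q[OF i] by (simp add: power_divide)
    ultimately have "q i \<le> 2 * (dotp d g (y i))\<^sup>2" using q[OF i] by (simp add: field_simps)
    then have "64 * r < 2 * (dotp d g (y i))\<^sup>2" using big[OF i] by (simp add: q_def)
    moreover have "(dotp d h (y i))\<^sup>2 = (dotp d g (y i))\<^sup>2 / 32"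
      unfolding h_def dotp_scale_left by (simp add: power_divide power_mult_distrib del: real_sqrt_mult)
    ultimately show "i \<in> {i\<in>B. r < (dotp d h (y i))\<^sup>2}" using i by simp
  qed
  then have "card C \<le> card {i\<in>B. r < (dotp d h (y i))\<^sup>2}" using B by (intro card_mono) auto
  ultimately show ?thesis using CB by (intro exI[of _ h]) (auto simp: N_def)
qed

text \<open>For a fixed mixture, the indices whose averaged squared projection exceeds 64r are
  deleted; rounding shows that they number at most 32 times \<epsilon>m/32, so uniform weights on
  the rest are admissible. Minimax gives common weights for finitely many directions, compactness
  for the whole unit ball, and homogeneity for all vectors.\<close>

lemma reweighing_exists:
  fixes y :: "nat \<Rightarrow> vect"
  assumes m: "0 < m" and eps: "0 < \<epsilon>" "\<epsilon> < 1" and r: "0 \<le> r"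
    and dir: "\<And>v. dotp d v v \<le> 1 \<Longrightarrow> real (card {i. i < m \<and> r < (dotp d v (y i))\<^sup>2}) \<le> \<epsilon> / 32 * real m"
  shows "\<exists>w\<in>weights m \<epsilon>. \<forall>v. (\<Sum>i<m. w i * (dotp d v (y i))\<^sup>2) \<le> 64 * r * dotp d v v"
proof -
  define K where "K = weights_ext m \<epsilon>"
  define l where "l = (\<lambda>v w. \<Sum>i<m. w i * (dotp d v (y i))\<^sup>2)"
  have cont: "continuous_on UNIV (l v)" for v
    unfolding l_def by (intro continuous_intros continuous_on_product_coordinates)
  have aff: "l v (mix t w w') = (1 - t) * l v w + t * l v w'" for v t w w'
    unfolding l_def mix_def sum_distrib_left sum.distrib[symmetric] by (intro sum.cong) (auto simp: algebra_simps)
  have mixture: "\<exists>w\<in>K. (\<Sum>v\<in>V. p v * l v w) \<le> 64 * r"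
    if V: "finite V" "V \<subseteq> {v. dotp d v v \<le> 1}" and p: "\<And>v. 0 \<le> p v" "sum p V = 1" for V p
  proof -
    define q where "q = (\<lambda>i. \<Sum>v\<in>V. p v * (dotp d v (y i))\<^sup>2)"
    define B where "B = {i. i < m \<and> 64 * r < q i}"
    define S where "S = {..<m} - B"
    have Bm: "B \<subseteq> {..<m}" "finite B" by (auto simp: B_def)
    obtain g where g: "dotp d g g \<le> 1" "card B \<le> 32 * card {i\<in>B. r < (dotp d g (y i))\<^sup>2}"
      using direction_from_mixture[OF V(1) _ p r Bm(2), of d y] V(2) unfolding B_def q_def by auto
    have "card {i\<in>B. r < (dotp d g (y i))\<^sup>2} \<le> card {i. i < m \<and> r < (dotp d g (y i))\<^sup>2}"
      by (intro card_mono) (auto simp: B_def)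
    with dir[OF g(1)] g(2) have cB: "real (card B) \<le> \<epsilon> * real m" by simp
    have "card B \<le> m" using card_mono[OF _ Bm(1)] by simp
    then have "real (card S) = real m - real (card B)"
      unfolding S_def using Bm by (simp add: card_Diff_subset)
    with cB have cS: "(1 - \<epsilon>) * real m \<le> real (card S)" by (simp add: algebra_simps)
    moreover have "0 < (1 - \<epsilon>) * real m" using m eps by simp
    ultimately have cS0: "0 < real (card S)" by linarith
    define w where "w = (\<lambda>i. if i \<in> S then 1 / real (card S) else 0)"
    have "w \<in> K"
      using uniform_on_subset_weights[OF _ cS m eps(2)] unfolding K_def weights_ext_def w_def
      by (auto simp: S_def)
    moreover have "(\<Sum>v\<in>V. p v * l v w) \<le> 64 * r"
    proof -
      have "(\<Sum>v\<in>V. p v * l v w) = (\<Sum>v\<in>V. \<Sum>i<m. w i * (p v * (dotp d v (y i))\<^sup>2))"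
        unfolding l_def sum_distrib_left by (simp add: mult_ac)
      also have "\<dots> = (\<Sum>i<m. w i * q i)"
        unfolding q_def sum_distrib_left by (rule sum.swap)
      also have "\<dots> \<le> (\<Sum>i<m. w i * (64 * r))"
      proof (rule sum_mono)
        fix i assume "i \<in> {..<m}"
        then show "w i * q i \<le> w i * (64 * r)"
          by (cases "i \<in> S") (auto simp: w_def S_def B_def intro!: divide_right_mono)
      qed
      also have "\<dots> = 64 * r"
        using \<open>w \<in> K\<close> by (simp add: K_def weights_ext_def weights_def sum_distrib_right[symmetric])
      finally show ?thesis .
    qed
    ultimately show ?thesis by blast
  qed
  have K0: "K \<noteq> {}"
    using mixture[of "{\<lambda>_. 0}" "\<lambda>_. 1"] by (auto simp: dotp_def)
  have "K \<inter> (\<Inter>v\<in>{v. dotp d v v \<le> 1}. {w. l v w \<le> 64 * r}) \<noteq> {}"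
  proof (rule compact_imp_fip_image)
    show "compact K" unfolding K_def by (rule compact_weights_ext)
    show "closed {w. l v w \<le> 64 * r}" for v using cont by (intro closed_Collect_le) auto
    fix V :: "vect set" assume V: "finite V" "V \<subseteq> {v. dotp d v v \<le> 1}"
    have "\<exists>w\<in>K. \<forall>v\<in>V. l v w \<le> 64 * r"
      by (rule minimax_finite[OF V(1) _ K0 _ cont aff mixture[OF V]])
        (auto simp: K_def compact_weights_ext mix_weights_ext)
    then show "K \<inter> (\<Inter>v\<in>V. {w. l v w \<le> 64 * r}) \<noteq> {}" by blast
  qed
  then obtain w where w: "w \<in> K" "\<And>v. dotp d v v \<le> 1 \<Longrightarrow> l v w \<le> 64 * r" by blast
  have "l v w \<le> 64 * r * dotp d v v" for v
  proof (cases "dotp d v v = 0")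
    case True
    have "dotp d v (y i) = 0" for i using dotp_cauchy_schwarz[of d v "y i"] True by simp
    then show ?thesis by (simp add: l_def True)
  next
    case False
    then have pos: "0 < dotp d v v" by (simp add: order_less_le)
    define u where "u = (\<lambda>a. 1 / sqrt (dotp d v v) * v a)"
    have "dotp d u u \<le> 1" unfolding u_def dotp_scale_left dotp_scale_right using pos by simp
    from w(2)[OF this] have "l u w \<le> 64 * r" .
    moreover have "l u w = l v w / dotp d v v"
      unfolding l_def u_def dotp_scale_left sum_divide_distrib using pos
      by (intro sum.cong) (auto simp: power_divide power_mult_distrib)
    ultimately show ?thesis using pos by (simp add: divide_le_eq)
  qed
  with w(1) show ?thesis unfolding K_def weights_ext_def l_def by blast
qed

subsection \<open>Gaussian shifts\<close>

definition gauss :: "real \<Rightarrow> real measure" where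
  "gauss s = density lborel (\<lambda>x. ennreal (normal_density 0 s x))"

lemma sets_gauss [simp, measurable_cong]: "sets (gauss s) = sets borel"
  by (simp add: gauss_def)

lemma space_gauss [simp]: "space (gauss s) = UNIV"
  by (simp add: gauss_def)

lemma prob_space_gauss: "0 < s \<Longrightarrow> prob_space (gauss s)"
  unfolding gauss_def by (rule prob_space_normal_density)

lemma integral_gauss:
  fixes f :: "real \<Rightarrow> real"
  assumes "f \<in> borel_measurable borel"
  shows "(\<integral>x. f x \<partial>gauss s) = (\<integral>x. normal_density 0 s x * f x \<partial>lborel)"
  unfolding gauss_def using assms by (subst integral_density) auto

lemma integrable_gauss:
  fixes f :: "real \<Rightarrow> real"
  assumes "f \<in> borel_measurable borel"
  shows "integrable (gauss s) f \<longleftrightarrow> integrable lborel (\<lambda>x. normal_density 0 s x * f x)"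
  unfolding gauss_def using assms by (subst integrable_density) auto

lemma gauss_moments:
  assumes "0 < s"
  shows "integrable (gauss s) (\<lambda>x. x)" "(\<integral>x. x \<partial>gauss s) = 0"
    "integrable (gauss s) (\<lambda>x. x * x)" "(\<integral>x. x * x \<partial>gauss s) = s\<^sup>2"
proof -
  note o = normal_moment_odd[OF assms, of 0 0, simplified] and e = normal_moment_even[OF assms, of 0 1, simplified]
  show "integrable (gauss s) (\<lambda>x. x)" "(\<integral>x. x \<partial>gauss s) = 0"
    using o by (auto simp: integrable_gauss integral_gauss has_bochner_integral_iff)
  show "integrable (gauss s) (\<lambda>x. x * x)" "(\<integral>x. x * x \<partial>gauss s) = s\<^sup>2"
    using e by (auto simp: integrable_gauss integral_gauss has_bochner_integral_iff power2_eq_square)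
qed

lemma integrable_bounded_prob:
  fixes f :: "'a \<Rightarrow> real"
  assumes "prob_space M" "f \<in> borel_measurable M" "\<And>x. x \<in> space M \<Longrightarrow> \<bar>f x\<bar> \<le> C"
  shows "integrable M f"
proof -
  interpret prob_space M by fact
  show ?thesis using assms by (intro integrable_const_bound[of _ C]) auto
qed

text \<open>
  The Donsker--Varadhan inequality for a translate of a Gaussian, whose relative entropy is
  \<open>v\<^sup>2/(2s\<^sup>2)\<close>: change variables and apply Jensen's inequality.
\<close>

lemma gauss_shift_exp:
  fixes h :: "real \<Rightarrow> real"
  assumes s: "0 < s" and h [measurable]: "h \<in> borel_measurable borel" and C: "\<And>y. \<bar>h y\<bar> \<le> C"
  shows "exp ((\<integral>y. h (v + y) \<partial>gauss s) - v\<^sup>2 / (2 * s\<^sup>2)) \<le> (\<integral>y. exp (h y) \<partial>gauss s)"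
proof -
  interpret prob_space "gauss s" by (rule prob_space_gauss[OF s])
  \<comment> \<open>The part subtracted from \<open>h\<close> is the logarithm, up to sign, of the
    ratio of the shifted to the unshifted density. Its linear term has mean 0, so the mean of \<phi>
    is exactly the exponent on the left of the claim.\<close>
  define \<phi> where "\<phi> = (\<lambda>y. h (v + y) - (v / s\<^sup>2) * y - v\<^sup>2 / (2 * s\<^sup>2))"
  have [measurable]: "\<phi> \<in> borel_measurable borel" unfolding \<phi>_def by measurable
  have dens: "normal_density 0 s (v + y) * exp (h (v + y)) = normal_density 0 s y * exp (\<phi> y)" for y
  proof -
    have "- (v + y)\<^sup>2 / (2 * s\<^sup>2) = - y\<^sup>2 / (2 * s\<^sup>2) + (- (v / s\<^sup>2) * y - v\<^sup>2 / (2 * s\<^sup>2))"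
      using s by (simp add: field_simps power2_eq_square)
    then show ?thesis
      by (simp add: normal_density_def \<phi>_def exp_add[symmetric] exp_diff[symmetric] algebra_simps)
  qed
  have int_eh: "integrable (gauss s) (\<lambda>y. exp (h y))"
    using C by (intro integrable_bounded_prob[of _ _ "exp C"] prob_space_axioms) (auto simp: abs_le_iff)
  then have i1: "integrable lborel (\<lambda>y. normal_density 0 s y * exp (h y))"
    by (simp add: integrable_gauss)
  from lborel_integrable_real_affine[OF this, of 1 v]
  have int_phi: "integrable (gauss s) (\<lambda>y. exp (\<phi> y))"
    by (simp add: integrable_gauss dens)
  have "(\<integral>y. exp (h y) \<partial>gauss s) = (\<integral>y. normal_density 0 s y * exp (h y) \<partial>lborel)"
    by (simp add: integral_gauss)
  also have "\<dots> = (\<integral>y. normal_density 0 s (v + y) * exp (h (v + y)) \<partial>lborel)"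
    using lborel_integral_real_affine[of 1 "\<lambda>y. normal_density 0 s y * exp (h y)" v] by simp
  also have "\<dots> = (\<integral>y. exp (\<phi> y) \<partial>gauss s)"
    by (simp add: integral_gauss dens)
  finally have eq: "(\<integral>y. exp (h y) \<partial>gauss s) = (\<integral>y. exp (\<phi> y) \<partial>gauss s)" .
  have int_h: "integrable (gauss s) (\<lambda>y. h (v + y))"
    using C by (intro integrable_bounded_prob[of _ _ C] prob_space_axioms) auto
  have ip: "integrable (gauss s) \<phi>"
    unfolding \<phi>_def using int_h gauss_moments[OF s] by auto
  define m where "m = (\<integral>y. \<phi> y \<partial>gauss s)"
  have m: "m = (\<integral>y. h (v + y) \<partial>gauss s) - v\<^sup>2 / (2 * s\<^sup>2)"
    unfolding m_def \<phi>_def using int_h gauss_moments[OF s] by (simp add: prob_space[simplified])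
  \<comment> \<open>Jensen's inequality through the tangent of the exponential at the mean
    \<open>m\<close>.\<close>
  have "exp m = (\<integral>y. exp m * (1 + (\<phi> y - m)) \<partial>gauss s)"
    using ip by (simp add: m_def prob_space[simplified])
  also have "\<dots> \<le> (\<integral>y. exp (\<phi> y) \<partial>gauss s)"
  proof (rule integral_mono)
    fix y
    have "exp m * (1 + (\<phi> y - m)) \<le> exp m * exp (\<phi> y - m)" by (intro mult_left_mono exp_ge_add_one_self) auto
    then show "exp m * (1 + (\<phi> y - m)) \<le> exp (\<phi> y)" by (simp add: exp_add[symmetric])
  qed (use ip int_phi in auto)
  finally show ?thesis by (simp add: m eq)
qed

section \<open>Gaussian vectors and their moments\<close>

definition gauss_vec :: "real \<Rightarrow> 'i set \<Rightarrow> ('i \<Rightarrow> real) measure" where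
  "gauss_vec s I = PiM I (\<lambda>_. gauss s)"

lemma product_prob_space_gauss: "0 < s \<Longrightarrow> product_prob_space (\<lambda>_. gauss s)"
  by (rule product_prob_spaceI) (rule prob_space_gauss)

lemma prob_space_gauss_vec: "0 < s \<Longrightarrow> prob_space (gauss_vec s I)"
  unfolding gauss_vec_def by (intro prob_space_PiM prob_space_gauss)

text \<open>Relative entropy is additive over independent coordinates. In the induction,
  \<open>h'\<close> averages \<open>h\<close> over the shifted new coordinate: the one-dimensional
  inequality applies to each slice, the induction hypothesis to \<open>h'\<close>. Boundedness is
  inherited by \<open>h'\<close> and settles every integrability condition.\<close>

lemma gauss_vec_shift_exp:
  fixes h :: "('i \<Rightarrow> real) \<Rightarrow> real"
  assumes "finite I" and s: "0 < s" and "h \<in> borel_measurable (gauss_vec s I)"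
    and "\<And>x. x \<in> space (gauss_vec s I) \<Longrightarrow> \<bar>h x\<bar> \<le> C"
  shows "exp ((\<integral>x. h (\<lambda>i\<in>I. v i + x i) \<partial>gauss_vec s I) - (\<Sum>i\<in>I. (v i)\<^sup>2) / (2 * s\<^sup>2))
      \<le> (\<integral>x. exp (h x) \<partial>gauss_vec s I)"
  using assms(1,3,4)
proof (induction I arbitrary: h rule: finite_induct)
  case empty
  interpret prob_space "gauss_vec s ({} :: 'i set)" using s by (rule prob_space_gauss_vec)
  have sp: "space (gauss_vec s ({} :: 'i set)) = {\<lambda>_. undefined}"
    by (simp add: gauss_vec_def space_PiM)
  have "(\<integral>x. h (\<lambda>i\<in>{}. v i + x i) \<partial>gauss_vec s {}) = (\<integral>x. h (\<lambda>_. undefined) \<partial>gauss_vec s ({} :: 'i set))"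
    by (intro Bochner_Integration.integral_cong) (auto simp: sp restrict_def)
  moreover have "(\<integral>x. exp (h x) \<partial>gauss_vec s {}) = (\<integral>x. exp (h (\<lambda>_. undefined)) \<partial>gauss_vec s ({} :: 'i set))"
    by (intro Bochner_Integration.integral_cong) (auto simp: sp)
  ultimately show ?case by (simp add: prob_space)
next
  case (insert i I)
  interpret G: prob_space "gauss s" using s by (rule prob_space_gauss)
  interpret P: product_prob_space "\<lambda>_::'i. gauss s" using s by (rule product_prob_space_gauss)
  interpret I: prob_space "gauss_vec s I" using s by (rule prob_space_gauss_vec)
  interpret II: prob_space "gauss_vec s (insert i I)" using s by (rule prob_space_gauss_vec)
  note [measurable] = insert.prems(1)[unfolded gauss_vec_def]
  have upd [measurable]: "(\<lambda>(x, y). x(i := y)) \<in> PiM I (\<lambda>_. gauss s) \<Otimes>\<^sub>M gauss s \<rightarrow>\<^sub>M PiM (insert i I) (\<lambda>_. gauss s)"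
    by (rule measurable_add_dim)
  have upd_space: "x(i := y) \<in> space (gauss_vec s (insert i I))" if "x \<in> space (gauss_vec s I)" for x y
    using that by (auto simp: gauss_vec_def space_PiM PiE_def extensional_def)
  have hm: "(\<lambda>(x, y). h (x(i := y))) \<in> borel_measurable (PiM I (\<lambda>_. gauss s) \<Otimes>\<^sub>M gauss s)"
    using measurable_compose[OF upd insert.prems(1)[unfolded gauss_vec_def]] by (simp add: split_beta')
  have hx: "(\<lambda>y. h (x(i := y))) \<in> borel_measurable borel" if "x \<in> space (gauss_vec s I)" for x
    using measurable_compose_Pair1[OF that[unfolded gauss_vec_def] hm] by simp
  define h' where "h' = (\<lambda>x. \<integral>y. h (x(i := v i + y)) \<partial>gauss s)"
  have h'm: "h' \<in> borel_measurable (gauss_vec s I)"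
  proof -
    have "(\<lambda>(x, y). (x, v i + y)) \<in> PiM I (\<lambda>_. gauss s) \<Otimes>\<^sub>M gauss s \<rightarrow>\<^sub>M PiM I (\<lambda>_. gauss s) \<Otimes>\<^sub>M gauss s"
      by measurable
    from measurable_compose[OF this hm]
    have "(\<lambda>(x, y). h (x(i := v i + y))) \<in> borel_measurable (PiM I (\<lambda>_. gauss s) \<Otimes>\<^sub>M gauss s)"
      by (simp add: split_beta')
    then show ?thesis unfolding h'_def gauss_vec_def by (rule G.borel_measurable_lebesgue_integral)
  qed
  have h'C: "\<bar>h' x\<bar> \<le> C" if x: "x \<in> space (gauss_vec s I)" for x
  proof -
    have b: "\<bar>h (x(i := v i + y))\<bar> \<le> C" for y using insert.prems(2) upd_space[OF x] by blast
    have [measurable]: "(\<lambda>y. h (x(i := v i + y))) \<in> borel_measurable borel"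
      using measurable_compose[OF _ hx[OF x], of "\<lambda>y. v i + y" borel] by simp
    have "integrable (gauss s) (\<lambda>y. h (x(i := v i + y)))"
      using b by (intro integrable_bounded_prob[of _ _ C] G.prob_space_axioms) auto
    then have "\<bar>h' x\<bar> \<le> (\<integral>y. C \<partial>gauss s)"
      unfolding h'_def using b
      by (intro order.trans[OF integral_abs_bound] integral_mono) auto
    then show ?thesis by (simp add: G.prob_space[simplified])
  qed
  have int_eh: "integrable (gauss_vec s (insert i I)) (\<lambda>x. exp (h x))"
    using insert.prems
    by (intro integrable_bounded_prob[of _ _ "exp C"] II.prob_space_axioms) (auto simp: abs_le_iff)
  have shift [measurable]: "(\<lambda>x. \<lambda>j\<in>J. v j + x j) \<in> gauss_vec s J \<rightarrow>\<^sub>M gauss_vec s J" for J :: "'i set"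
    unfolding gauss_vec_def by (rule measurable_restrict) measurable
  have int_hs: "integrable (gauss_vec s (insert i I)) (\<lambda>x. h (\<lambda>j\<in>insert i I. v j + x j))"
    using insert.prems measurable_space[OF shift]
    by (intro integrable_bounded_prob[of _ _ C] II.prob_space_axioms measurable_compose[OF shift]) auto
  have "exp ((\<integral>x. h' (\<lambda>j\<in>I. v j + x j) \<partial>gauss_vec s I) - (\<Sum>j\<in>I. (v j)\<^sup>2) / (2 * s\<^sup>2) - (v i)\<^sup>2 / (2 * s\<^sup>2))
      \<le> (\<integral>x. exp (h' x) \<partial>gauss_vec s I) * exp (- (v i)\<^sup>2 / (2 * s\<^sup>2))"
  proof -
    have "exp (a - b - c / e) \<le> z * exp (- c / e)" if "exp (a - b) \<le> z" for a b c e z :: real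
      using mult_right_mono[OF that, of "exp (- c / e)"] by (simp add: exp_add[symmetric])
    then show ?thesis by this (rule insert.IH[OF h'm h'C])
  qed
  also have "\<dots> = (\<integral>x. exp (h' x) * exp (- (v i)\<^sup>2 / (2 * s\<^sup>2)) \<partial>gauss_vec s I)"
    by simp
  also have "\<dots> \<le> (\<integral>x. (\<integral>y. exp (h (x(i := y))) \<partial>gauss s) \<partial>gauss_vec s I)"
  proof (rule integral_mono)
    show "integrable (gauss_vec s I) (\<lambda>x. exp (h' x) * exp (- (v i)\<^sup>2 / (2 * s\<^sup>2)))"
      using h'm h'C by (intro integrable_mult_left integrable_bounded_prob[of _ _ "exp C"] I.prob_space_axioms)
        (auto simp: abs_le_iff)
    show "integrable (gauss_vec s I) (\<lambda>x. \<integral>y. exp (h (x(i := y))) \<partial>gauss s)"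
    proof (rule integrable_bounded_prob[of _ _ "exp C"])
      have "(\<lambda>(x, y). exp (h (x(i := y)))) \<in> borel_measurable (PiM I (\<lambda>_. gauss s) \<Otimes>\<^sub>M gauss s)"
        using measurable_compose[OF hm borel_measurable_exp] by (simp add: split_beta')
      then show "(\<lambda>x. \<integral>y. exp (h (x(i := y))) \<partial>gauss s) \<in> borel_measurable (gauss_vec s I)"
        unfolding gauss_vec_def by (rule G.borel_measurable_lebesgue_integral)
      fix x assume x: "x \<in> space (gauss_vec s I)"
      note [measurable] = hx[OF x]
      have b: "exp (h (x(i := y))) \<le> exp C" for y
        by (subst exp_le_cancel_iff) (rule abs_le_D1[OF insert.prems(2)[OF upd_space[OF x]]])
      have "integrable (gauss s) (\<lambda>y. exp (h (x(i := y))))"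
        using b by (intro integrable_bounded_prob[of _ _ "exp C"] G.prob_space_axioms) auto
      then have "(\<integral>y. exp (h (x(i := y))) \<partial>gauss s) \<le> (\<integral>y. exp C \<partial>gauss s)"
        using b by (intro integral_mono) auto
      then show "\<bar>\<integral>y. exp (h (x(i := y))) \<partial>gauss s\<bar> \<le> exp C"
        by (simp add: G.prob_space[simplified] abs_of_nonneg integral_nonneg)
    qed (rule I.prob_space_axioms)
    fix x assume x: "x \<in> space (gauss_vec s I)"
    have "\<bar>h (x(i := y))\<bar> \<le> C" for y using insert.prems(2)[OF upd_space[OF x]] .
    from gauss_shift_exp[OF s hx[OF x] this, of "v i"]
    show "exp (h' x) * exp (- (v i)\<^sup>2 / (2 * s\<^sup>2)) \<le> (\<integral>y. exp (h (x(i := y))) \<partial>gauss s)"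
      by (simp add: h'_def exp_add[symmetric])
  qed
  also have "\<dots> = (\<integral>x. exp (h x) \<partial>gauss_vec s (insert i I))"
    unfolding gauss_vec_def
    by (rule P.product_integral_insert[symmetric, OF insert.hyps int_eh[unfolded gauss_vec_def]])
  finally have main: "exp ((\<integral>x. h' (\<lambda>j\<in>I. v j + x j) \<partial>gauss_vec s I) - (\<Sum>j\<in>I. (v j)\<^sup>2) / (2 * s\<^sup>2) - (v i)\<^sup>2 / (2 * s\<^sup>2))
      \<le> (\<integral>x. exp (h x) \<partial>gauss_vec s (insert i I))" .
  have "(\<integral>x. h (\<lambda>j\<in>insert i I. v j + x j) \<partial>gauss_vec s (insert i I)) =
      (\<integral>x. (\<integral>y. h (\<lambda>j\<in>insert i I. v j + (x(i := y)) j) \<partial>gauss s) \<partial>gauss_vec s I)"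
    unfolding gauss_vec_def
    by (rule P.product_integral_insert[OF insert.hyps int_hs[unfolded gauss_vec_def]])
  also have "\<dots> = (\<integral>x. h' (\<lambda>j\<in>I. v j + x j) \<partial>gauss_vec s I)"
  proof -
    have "(\<lambda>j\<in>insert i I. v j + (x(i := y)) j) = (\<lambda>j\<in>I. v j + x j)(i := v i + y)" for x y
      using insert.hyps by (auto simp: fun_eq_iff)
    then show ?thesis unfolding h'_def by simp
  qed
  finally have eq: "(\<integral>x. h (\<lambda>j\<in>insert i I. v j + x j) \<partial>gauss_vec s (insert i I)) = (\<integral>x. h' (\<lambda>j\<in>I. v j + x j) \<partial>gauss_vec s I)" .
  have ar: "A - (\<Sum>j\<in>insert i I. (v j)\<^sup>2) / (2 * s\<^sup>2) = A - (\<Sum>j\<in>I. (v j)\<^sup>2) / (2 * s\<^sup>2) - (v i)\<^sup>2 / (2 * s\<^sup>2)" for A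
    using insert.hyps by (simp add: add_divide_distrib)
  show ?case unfolding eq ar by (rule main)
qed

text \<open>Each integrand is a product over all coordinates with factor 1 outside \<open>a\<close>
  and \<open>b\<close>, so Fubini for products applies and a = b needs no separate argument. It
  serves both Gaussian coordinates and samples.\<close>

lemma product_second_moments:
  fixes f :: "'a \<Rightarrow> real" and a b :: 'i
  assumes N: "prob_space N" and ab: "a \<in> I" "b \<in> I" and I: "finite I"
    and f: "integrable N f" "integrable N (\<lambda>y. f y * f y)"
  shows "integrable (PiM I (\<lambda>_. N)) (\<lambda>x. f (x a))"
    "(\<integral>x. f (x a) \<partial>PiM I (\<lambda>_. N)) = (\<integral>y. f y \<partial>N)"
    "integrable (PiM I (\<lambda>_. N)) (\<lambda>x. f (x a) * f (x b))"
    "(\<integral>x. f (x a) * f (x b) \<partial>PiM I (\<lambda>_. N)) =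
      (if a = b then \<integral>y. f y * f y \<partial>N else (\<integral>y. f y \<partial>N)\<^sup>2)"
proof -
  interpret N: prob_space N by fact
  interpret P: product_prob_space "\<lambda>_::'i. N" by (rule product_prob_spaceI) (rule N)
  define p where "p = (\<lambda>j y. if j = a then f y else 1)"
  define g where "g = (\<lambda>j y. (if j = a then f y else 1) * (if j = b then f y else 1))"
  have pi: "integrable N (p j)" for j
    unfolding p_def using f(1) by (cases "j = a") simp_all
  have gi: "integrable N (g j)" for j
    unfolding g_def using f by (cases "j = a"; cases "j = b") simp_all
  have pint: "(\<integral>y. p j y \<partial>N) = (if j = a then \<integral>y. f y \<partial>N else 1)" for j
    unfolding p_def using N.prob_space by (cases "j = a") simp_all
  have gint: "(\<integral>y. g j y \<partial>N) =
      (if j = a then if j = b then \<integral>y. f y * f y \<partial>N else \<integral>y. f y \<partial>N else if j = b then \<integral>y. f y \<partial>N else 1)" for j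
    unfolding g_def using N.prob_space by (cases "j = a"; cases "j = b") simp_all
  have pp: "(\<Prod>j\<in>I. p j (x j)) = f (x a)" for x
    using ab I by (simp add: p_def)
  have gp: "(\<Prod>j\<in>I. g j (x j)) = f (x a) * f (x b)" for x
    using ab I by (simp add: g_def prod.distrib)
  show "integrable (PiM I (\<lambda>_. N)) (\<lambda>x. f (x a))"
    using P.product_integrable_prod[OF I, of p] pi by (simp add: pp)
  show "integrable (PiM I (\<lambda>_. N)) (\<lambda>x. f (x a) * f (x b))"
    using P.product_integrable_prod[OF I, of g] gi by (simp add: gp)
  show "(\<integral>x. f (x a) \<partial>PiM I (\<lambda>_. N)) = (\<integral>y. f y \<partial>N)"
    using P.product_integral_prod[OF I, of p] pi ab I by (simp add: pp pint)
  have "(\<Prod>j\<in>I. \<integral>y. g j y \<partial>N) =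
      (\<Prod>j\<in>I. (if j = a then if a = b then \<integral>y. f y * f y \<partial>N else \<integral>y. f y \<partial>N else 1) *
        (if j = b then if a = b then 1 else \<integral>y. f y \<partial>N else 1))"
    by (intro prod.cong) (auto simp: gint)
  also have "\<dots> = (if a = b then \<integral>y. f y * f y \<partial>N else (\<integral>y. f y \<partial>N)\<^sup>2)"
    using ab I by (simp add: prod.distrib power2_eq_square)
  finally show "(\<integral>x. f (x a) * f (x b) \<partial>PiM I (\<lambda>_. N)) =
      (if a = b then \<integral>y. f y * f y \<partial>N else (\<integral>y. f y \<partial>N)\<^sup>2)"
    using P.product_integral_prod[OF I, of g] gi by (simp add: gp)
qed

lemma gauss_vec_moments:
  assumes s: "0 < s" and ab: "a \<in> I" "b \<in> I" and I: "finite I"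
  shows "integrable (gauss_vec s I) (\<lambda>x. x a)" "(\<integral>x. x a \<partial>gauss_vec s I) = 0"
    "integrable (gauss_vec s I) (\<lambda>x. x a * x b)"
    "(\<integral>x. x a * x b \<partial>gauss_vec s I) = (if a = b then s\<^sup>2 else 0)"
  using product_second_moments[OF prob_space_gauss[OF s] ab I gauss_moments(1,3)[OF s]]
  by (simp_all add: gauss_vec_def gauss_moments(2,4)[OF s])

definition quad :: "nat \<Rightarrow> matr \<Rightarrow> vect \<Rightarrow> real" where
  "quad d S v = (\<Sum>a<d. \<Sum>b<d. v a * S a b * v b)"

text \<open>The linear terms have mean 0 and the coordinates are uncorrelated with variance s^2, so
  only the diagonal of \<open>S\<close> is added. This is how the trace enters the error
  bound.\<close>

lemma gauss_vec_quad:
  assumes s: "0 < s"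
  shows "integrable (gauss_vec s {..<d}) (\<lambda>x. quad d S (\<lambda>a. v a + x a))"
    "(\<integral>x. quad d S (\<lambda>a. v a + x a) \<partial>gauss_vec s {..<d}) = quad d S v + s\<^sup>2 * trace_matr d S"
proof -
  interpret prob_space "gauss_vec s {..<d}" using s by (rule prob_space_gauss_vec)
  have eq: "quad d S (\<lambda>a. v a + x a) =
      (\<Sum>a<d. \<Sum>b<d. S a b * (v a * v b) + S a b * v a * x b + S a b * v b * x a + S a b * (x a * x b))" for x
    unfolding quad_def by (intro sum.cong) (auto simp: algebra_simps)
  have i: "integrable (gauss_vec s {..<d}) (\<lambda>x. S a b * (v a * v b) + S a b * v a * x b + S a b * v b * x a + S a b * (x a * x b))"
    if "a \<in> {..<d}" "b \<in> {..<d}" for a b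
    using that s gauss_vec_moments(1,3)[of s _ "{..<d}"] by (intro Bochner_Integration.integrable_add integrable_mult_right) auto
  show "integrable (gauss_vec s {..<d}) (\<lambda>x. quad d S (\<lambda>a. v a + x a))"
    unfolding eq using i by (intro Bochner_Integration.integrable_sum) auto
  have I: "(\<integral>x. S a b * (v a * v b) + S a b * v a * x b + S a b * v b * x a + S a b * (x a * x b) \<partial>gauss_vec s {..<d})
      = v a * S a b * v b + (if a = b then s\<^sup>2 * S a b else 0)" if "a \<in> {..<d}" "b \<in> {..<d}" for a b
    using that s gauss_vec_moments[of s _ "{..<d}"] by (simp add: prob_space)
  have "(\<integral>x. quad d S (\<lambda>a. v a + x a) \<partial>gauss_vec s {..<d}) =
      (\<Sum>a<d. \<Sum>b<d. v a * S a b * v b + (if a = b then s\<^sup>2 * S a b else 0))"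
    unfolding eq
    by (subst Bochner_Integration.integral_sum, intro Bochner_Integration.integrable_sum i, assumption+)
      (intro sum.cong refl, subst Bochner_Integration.integral_sum, auto intro: i intro!: sum.cong I)
  then show "(\<integral>x. quad d S (\<lambda>a. v a + x a) \<partial>gauss_vec s {..<d}) = quad d S v + s\<^sup>2 * trace_matr d S"
    by (simp add: quad_def trace_matr_def sum.distrib sum_distrib_left)
qed

subsection \<open>Simultaneous control of all directions\<close>

lemma dotp_restrict: "dotp d (\<lambda>a\<in>{..<d}. u a) y = dotp d u y"
  unfolding dotp_def by (intro sum.cong) auto

lemma quad_restrict: "quad d S (\<lambda>a\<in>{..<d}. u a) = quad d S u"
  unfolding quad_def by (intro sum.cong) auto

lemma measurable_gauss_vec_component:
  "a < d \<Longrightarrow> (\<lambda>x. x a) \<in> borel_measurable (gauss_vec s {..<d})"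
  unfolding gauss_vec_def by measurable

lemma prod_mono_ennreal:
  fixes f g :: "'i \<Rightarrow> ennreal"
  assumes "\<And>i. i \<in> I \<Longrightarrow> f i \<le> g i"
  shows "prod f I \<le> prod g I"
  using assms by (induction I rule: infinite_finite_induct) (auto intro: mult_mono)

text \<open>The exponential moment of a Bernoulli variable, bounded by 1 + t \<le> exp t so that the
  factors of independent buckets multiply into a single exponent.\<close>

lemma nn_integral_exp_on_event_le:
  assumes "prob_space M" and A: "A \<in> sets M" and L: "0 \<le> L" and q: "measure M A \<le> q"
  shows "(\<integral>\<^sup>+x. ennreal (if x \<in> A then exp L else 1) \<partial>M) \<le> ennreal (exp (exp L * q))"
proof -
  interpret prob_space M by fact
  have "(\<integral>\<^sup>+x. ennreal (if x \<in> A then exp L else 1) \<partial>M) = (\<integral>\<^sup>+x. (1 + ennreal (exp L - 1) * indicator A x) \<partial>M)"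
  proof -
    have "ennreal (exp L) = 1 + ennreal (exp L - 1)"
      using L ennreal_plus[of 1 "exp L - 1"] by simp
    then show ?thesis by (intro nn_integral_cong) (auto simp: indicator_def)
  qed
  also have "\<dots> = 1 + ennreal (exp L - 1) * emeasure M A"
    using A by (subst nn_integral_add) (auto simp: emeasure_space_1 nn_integral_cmult)
  also have "\<dots> = ennreal (1 + (exp L - 1) * measure M A)"
    using L by (simp add: emeasure_eq_measure ennreal_mult)
  also have "\<dots> \<le> ennreal (exp (exp L * q))"
  proof (rule ennreal_leI)
    have "1 + (exp L - 1) * measure M A \<le> 1 + exp L * q"
      using q L by (intro add_left_mono mult_mono) auto
    also have "\<dots> \<le> exp (exp L * q)" by (rule exp_ge_add_one_self)
    finally show "1 + (exp L - 1) * measure M A \<le> exp (exp L * q)" .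
  qed
  finally show ?thesis .
qed

text \<open>
  The PAC-Bayes argument. For a Gaussian direction \<open>\<theta>\<close> with covariance \<open>I/k\<close>, the exponential
  moment of the penalised count of large projections is at most 1; the entropy inequality
  transfers this to Gaussians centred at \<open>v\<close> and \<open>- v\<close>, simultaneously for all \<open>v\<close>. The smoothing is
  undone by \<open>max \<bar>a + t\<bar> \<bar>- a + t\<bar> \<ge> \<bar>a\<bar>\<close>. When \<open>r = 0\<close>, the tail assumption reads
  \<open>prob \<dots> \<le> 0\<close>, as \<open>x / 0 = 0\<close>.
\<close>

lemma uniform_direction_count:
  fixes Y :: "nat \<Rightarrow> 'a \<Rightarrow> vect" and S :: matr
  assumes M: "prob_space M" and k: "0 < k" and L: "0 \<le> L" and r: "0 \<le> r" and \<delta>: "0 < \<delta>"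
    and Y: "\<And>j a. j < k \<Longrightarrow> a < d \<Longrightarrow> (\<lambda>x. Y j x a) \<in> borel_measurable M"
    and ind: "\<And>\<theta>. prob_space.indep_vars M (\<lambda>_. borel) (\<lambda>j x. dotp d \<theta> (Y j x)) {..<k}"
    and tail: "\<And>\<theta> j. j < k \<Longrightarrow> measure M {x \<in> space M. r < (dotp d \<theta> (Y j x))\<^sup>2} \<le> quad d S \<theta> / r"
  shows "\<exists>E\<in>sets M. 1 - \<delta> \<le> measure M E \<and>
    (\<forall>x\<in>E. \<forall>v. dotp d v v \<le> 1 \<longrightarrow>
      L * real (card {j. j < k \<and> r < (dotp d v (Y j x))\<^sup>2})
        \<le> real k + 2 * ln (1 / \<delta>) + 2 * real k * exp L * ((quad d S v + trace_matr d S / real k) / r))"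
proof -
  interpret M: prob_space M by fact
  define s where "s = 1 / sqrt (real k)"
  have s: "0 < s" "s\<^sup>2 = 1 / real k" using k by (auto simp: s_def power_divide)
  define G where "G = gauss_vec s {..<d}"
  interpret G: prob_space G unfolding G_def using s(1) by (rule prob_space_gauss_vec)
  interpret MG: pair_sigma_finite M G by unfold_locales
  \<comment> \<open>A tail probability is at most 1, so the cap is harmless, and it makes
    \<open>h\<close> bounded, as the entropy inequality demands.\<close>
  define c where "c = (\<lambda>\<theta>. min 1 (quad d S \<theta> / r))"
  define cnt where "cnt = (\<lambda>x \<theta>. \<Sum>j<k. if r < (dotp d \<theta> (Y j x))\<^sup>2 then L else 0)"
  define h where "h = (\<lambda>x \<theta>. cnt x \<theta> - real k * exp L * c \<theta>)"
  have q0: "0 \<le> quad d S \<theta> / r" for \<theta>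
    using order_trans[OF measure_nonneg tail[OF k]] .
  have c01: "0 \<le> c \<theta>" "c \<theta> \<le> 1" "c \<theta> \<le> quad d S \<theta> / r" for \<theta>
    using q0 by (auto simp: c_def)
  have cnt_eq: "cnt x \<theta> = L * real (card {j. j < k \<and> r < (dotp d \<theta> (Y j x))\<^sup>2})" for x \<theta>
    unfolding cnt_def by (simp add: sum.If_cases Int_def mult.commute)
  have cnt_b: "0 \<le> cnt x \<theta>" "cnt x \<theta> \<le> real k * L" for x \<theta>
    using L sum_bounded_above[of "{..<k}" "\<lambda>j. if r < (dotp d \<theta> (Y j x))\<^sup>2 then L else 0" L]
    by (auto simp: cnt_def intro!: sum_nonneg)
  define C where "C = real k * L + real k * exp L"
  have h_b: "\<bar>h x \<theta>\<bar> \<le> C" for x \<theta>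
  proof -
    have "0 \<le> real k * exp L * c \<theta>" "real k * exp L * c \<theta> \<le> real k * exp L"
      using c01[of \<theta>] by (auto intro!: mult_left_le)
    then show ?thesis using cnt_b[of x \<theta>] by (simp add: h_def C_def)
  qed
  have dm [measurable]: "(\<lambda>z. dotp d (snd z) (Y j (fst z))) \<in> borel_measurable (M \<Otimes>\<^sub>M G)" if "j < k" for j
    unfolding dotp_def G_def using that
    by (intro borel_measurable_sum borel_measurable_times
        measurable_compose[OF measurable_snd measurable_gauss_vec_component]
        measurable_compose[OF measurable_fst Y]) auto
  have qm: "(\<lambda>\<theta>. quad d S \<theta>) \<in> borel_measurable G"
    unfolding quad_def G_def
    by (intro borel_measurable_sum borel_measurable_times measurable_gauss_vec_component) auto
  have cm: "c \<in> borel_measurable G" unfolding c_def using qm by measurable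
  have hm: "(\<lambda>(x, \<theta>). h x \<theta>) \<in> borel_measurable (M \<Otimes>\<^sub>M G)"
  proof -
    have "(\<lambda>z. cnt (fst z) (snd z)) \<in> borel_measurable (M \<Otimes>\<^sub>M G)"
      unfolding cnt_def using dm
      by (intro borel_measurable_sum measurable_If borel_measurable_const) auto
    moreover have "(\<lambda>z. c (snd z)) \<in> borel_measurable (M \<Otimes>\<^sub>M G)"
      using cm by (rule measurable_compose[OF measurable_snd])
    ultimately show ?thesis unfolding h_def split_beta' by measurable
  qed
  have hxm: "h x \<in> borel_measurable G" if "x \<in> space M" for x
    using measurable_compose_Pair1[OF that hm] by simp
  define Z where "Z = (\<lambda>x. \<integral>\<theta>. exp (h x \<theta>) \<partial>G)"
  have ehm: "(\<lambda>(x, \<theta>). exp (h x \<theta>)) \<in> borel_measurable (M \<Otimes>\<^sub>M G)"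
    using measurable_compose[OF hm borel_measurable_exp] by (simp add: split_beta')
  have Zm [measurable]: "Z \<in> borel_measurable M"
    unfolding Z_def using ehm by (rule G.borel_measurable_lebesgue_integral)
  have eh_int: "integrable G (\<lambda>\<theta>. exp (h x \<theta>))" if "x \<in> space M" for x
    using h_b hxm[OF that]
    by (intro integrable_bounded_prob[of _ _ "exp C"] G.prob_space_axioms) (auto simp: abs_le_iff)
  have Z0: "0 \<le> Z x" for x unfolding Z_def by (rule Bochner_Integration.integral_nonneg) simp
  have ZC: "Z x \<le> exp C" if "x \<in> space M" for x
  proof -
    have "Z x \<le> (\<integral>\<theta>. exp C \<partial>G)"
      unfolding Z_def using h_b eh_int[OF that] by (intro integral_mono) (auto simp: abs_le_iff)
    then show ?thesis by (simp add: G.prob_space)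
  qed
  have Zint: "integrable M Z"
    using Z0 ZC by (intro integrable_bounded_prob[of _ _ "exp C"] M.prob_space_axioms) auto
  \<comment> \<open>For a fixed direction the buckets are independent; the penalty in
    \<open>h\<close> is chosen to cancel the product of their k exponential moments.\<close>
  have inner: "(\<integral>\<^sup>+x. ennreal (exp (h x \<theta>)) \<partial>M) \<le> 1" for \<theta>
  proof -
    define X where "X = (\<lambda>j x. if r < (dotp d \<theta> (Y j x))\<^sup>2 then exp L else 1)"
    have dt: "(\<lambda>x. dotp d \<theta> (Y j x)) \<in> borel_measurable M" if "j < k" for j
      unfolding dotp_def using Y that by (intro borel_measurable_sum borel_measurable_times) auto
    have indX: "M.indep_vars (\<lambda>_. borel) (\<lambda>j x. X j x) {..<k}"
      unfolding X_def
      by (rule M.indep_vars_compose2[OF ind, where Y = "\<lambda>_ t. if r < t\<^sup>2 then exp L else 1"]) measurable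
    have Xm: "X j \<in> borel_measurable M" if "j < k" for j
      unfolding X_def using dt[OF that] by measurable
    have "exp (h x \<theta>) = exp (- (real k * exp L * c \<theta>)) * (\<Prod>j<k. X j x)" for x
    proof -
      have "exp (cnt x \<theta>) = (\<Prod>j<k. X j x)"
        unfolding cnt_def X_def by (subst exp_sum) (auto intro!: prod.cong)
      then show ?thesis by (simp add: h_def exp_diff exp_minus field_simps)
    qed
    then have "(\<integral>\<^sup>+x. ennreal (exp (h x \<theta>)) \<partial>M) =
        (\<integral>\<^sup>+x. ennreal (exp (- (real k * exp L * c \<theta>))) * (\<Prod>j<k. ennreal (X j x)) \<partial>M)"
      by (intro nn_integral_cong) (simp add: ennreal_mult' prod_ennreal X_def prod_nonneg)
    also have "\<dots> = ennreal (exp (- (real k * exp L * c \<theta>))) * (\<integral>\<^sup>+x. (\<Prod>j<k. ennreal (X j x)) \<partial>M)"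
      using Xm by (intro nn_integral_cmult borel_measurable_prod_ennreal) auto
    also have "(\<integral>\<^sup>+x. (\<Prod>j<k. ennreal (X j x)) \<partial>M) = (\<Prod>j<k. \<integral>\<^sup>+x. ennreal (X j x) \<partial>M)"
      by (intro M.indep_vars_nn_integral M.indep_vars_compose2[OF indX]) auto
    also have "\<dots> \<le> (\<Prod>j<k. ennreal (exp (exp L * c \<theta>)))"
    proof (rule prod_mono_ennreal)
      fix j assume "j \<in> {..<k}"
      then have j: "j < k" by simp
      define A where "A = {x \<in> space M. r < (dotp d \<theta> (Y j x))\<^sup>2}"
      have A: "A \<in> sets M" unfolding A_def using dt[OF j] by measurable
      have "measure M A \<le> c \<theta>" unfolding c_def A_def using tail[OF j, of \<theta>] by simp
      from nn_integral_exp_on_event_le[OF M A L this]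
      have "(\<integral>\<^sup>+x. ennreal (if x \<in> A then exp L else 1) \<partial>M) \<le> ennreal (exp (exp L * c \<theta>))" .
      also have "(\<integral>\<^sup>+x. ennreal (if x \<in> A then exp L else 1) \<partial>M) = (\<integral>\<^sup>+x. ennreal (X j x) \<partial>M)"
        by (intro nn_integral_cong) (auto simp: A_def X_def)
      finally show "(\<integral>\<^sup>+x. ennreal (X j x) \<partial>M) \<le> ennreal (exp (exp L * c \<theta>))" .
    qed
    also have "(\<Prod>j<k. ennreal (exp (exp L * c \<theta>))) = ennreal (exp (real k * exp L * c \<theta>))"
      by (simp add: ennreal_power exp_of_nat_mult[symmetric] mult.assoc)
    finally have "(\<integral>\<^sup>+x. ennreal (exp (h x \<theta>)) \<partial>M)
        \<le> ennreal (exp (- (real k * exp L * c \<theta>))) * ennreal (exp (real k * exp L * c \<theta>))"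
      by (simp add: mult_left_mono)
    also have "\<dots> = 1" by (simp add: ennreal_mult'[symmetric] exp_add[symmetric])
    finally show ?thesis .
  qed
  have "ennreal (\<integral>x. Z x \<partial>M) = (\<integral>\<^sup>+x. ennreal (Z x) \<partial>M)"
    using Zint Z0 by (intro nn_integral_eq_integral[symmetric]) auto
  also have "\<dots> = (\<integral>\<^sup>+x. \<integral>\<^sup>+\<theta>. ennreal (exp (h x \<theta>)) \<partial>G \<partial>M)"
    unfolding Z_def using eh_int by (intro nn_integral_cong nn_integral_eq_integral[symmetric]) auto
  also have "\<dots> = (\<integral>\<^sup>+\<theta>. \<integral>\<^sup>+x. ennreal (exp (h x \<theta>)) \<partial>M \<partial>G)"
  proof (rule MG.Fubini'[symmetric])
    show "(\<lambda>(x, \<theta>). ennreal (exp (h x \<theta>))) \<in> borel_measurable (M \<Otimes>\<^sub>M G)"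
      using measurable_compose[OF ehm measurable_ennreal] by (simp add: split_beta')
  qed
  also have "\<dots> \<le> (\<integral>\<^sup>+\<theta>. 1 \<partial>G)" by (intro nn_integral_mono inner)
  also have "\<dots> = 1" by (simp add: G.emeasure_space_1)
  finally have EZ: "(\<integral>x. Z x \<partial>M) \<le> 1" by simp
  define E where "E = {x \<in> space M. Z x < 1 / \<delta>}"
  have E: "E \<in> sets M" unfolding E_def by measurable
  have "measure M {x \<in> space M. 1 / \<delta> \<le> Z x} \<le> (\<integral>x. Z x \<partial>M) / (1 / \<delta>)"
    using Zint Z0 \<delta> by (intro integral_Markov_inequality_measure[where A = "{}"]) auto
  also have "\<dots> \<le> \<delta>" using EZ \<delta> by (simp add: mult_left_le_one_le)
  finally have mk: "measure M {x \<in> space M. 1 / \<delta> \<le> Z x} \<le> \<delta>" .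
  have "measure M E = 1 - measure M (space M - E)" using M.prob_compl[OF E] by simp
  also have "space M - E = {x \<in> space M. 1 / \<delta> \<le> Z x}" by (auto simp: E_def)
  finally have ME: "1 - \<delta> \<le> measure M E" using mk by simp
  \<comment> \<open>As s^2 = 1/k, a shift by a vector of norm at most 1 costs at most k/2. The event
    \<open>E\<close> does not depend on \<open>v\<close>, so the bound holds for all directions at
    once; using it for \<open>v\<close> and its negative doubles it to k + 2 ln(1/\<delta>).\<close>
  have shifted: "(\<integral>\<theta>. h x (\<lambda>a\<in>{..<d}. v a + \<theta> a) \<partial>G) \<le> real k / 2 + ln (1 / \<delta>)"
    if x: "x \<in> E" and v: "dotp d v v \<le> 1" for x v
  proof -
    have xs: "x \<in> space M" using x by (simp add: E_def)
    have "exp ((\<integral>\<theta>. h x (\<lambda>a\<in>{..<d}. v a + \<theta> a) \<partial>G) - (\<Sum>a<d. (v a)\<^sup>2) / (2 * s\<^sup>2)) \<le> Z x"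
      unfolding Z_def G_def using hxm[OF xs] h_b s(1)
      by (intro gauss_vec_shift_exp[of _ _ _ C]) (auto simp: G_def)
    also have "\<dots> < 1 / \<delta>" using x by (simp add: E_def)
    also have "\<dots> = exp (ln (1 / \<delta>))" using \<delta> by simp
    finally have "(\<integral>\<theta>. h x (\<lambda>a\<in>{..<d}. v a + \<theta> a) \<partial>G) - (\<Sum>a<d. (v a)\<^sup>2) / (2 * s\<^sup>2) < ln (1 / \<delta>)"
      by (simp only: exp_less_cancel_iff)
    moreover have "(\<Sum>a<d. (v a)\<^sup>2) / (2 * s\<^sup>2) = real k / 2 * dotp d v v"
      unfolding s(2) by (simp add: dotp_def power2_eq_square)
    moreover have "real k / 2 * dotp d v v \<le> real k / 2 * 1" using v by (intro mult_left_mono) auto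
    ultimately show ?thesis by linarith
  qed
  have shift_m: "(\<lambda>\<theta>. \<lambda>a\<in>{..<d}. v a + \<theta> a) \<in> G \<rightarrow>\<^sub>M G" for v
    unfolding G_def gauss_vec_def by (rule measurable_restrict) measurable
  have "L * real (card {j. j < k \<and> r < (dotp d v (Y j x))\<^sup>2})
        \<le> real k + 2 * ln (1 / \<delta>) + 2 * real k * exp L * ((quad d S v + trace_matr d S / real k) / r)"
    if x: "x \<in> E" and v: "dotp d v v \<le> 1" for x v
  proof -
    have xs: "x \<in> space M" using x by (simp add: E_def)
    define u where "u = (\<lambda>a. - v a)"
    have u: "dotp d u u \<le> 1" using v by (simp add: u_def dotp_def)
    have qu: "quad d S u = quad d S v" by (simp add: u_def quad_def)
    define K where "K = cnt x v"
    define W where "W = (\<lambda>v. \<integral>\<theta>. h x (\<lambda>a\<in>{..<d}. v a + \<theta> a) \<partial>G)"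
    have hint: "integrable G (\<lambda>\<theta>. h x (\<lambda>a\<in>{..<d}. v a + \<theta> a))" for v
      using h_b by (intro integrable_bounded_prob[of _ _ C] G.prob_space_axioms
          measurable_compose[OF shift_m hxm[OF xs]]) auto
    have qint: "integrable G (\<lambda>\<theta>. quad d S (\<lambda>a. v a + \<theta> a) / r)"
      "(\<integral>\<theta>. quad d S (\<lambda>a. v a + \<theta> a) / r \<partial>G) = (quad d S v + trace_matr d S / real k) / r" for v
      using gauss_vec_quad[OF s(1), of d S v] by (auto simp: G_def s(2))
    have pt: "K - real k * exp L * (quad d S (\<lambda>a. v a + \<theta> a) / r + quad d S (\<lambda>a. u a + \<theta> a) / r)
        \<le> h x (\<lambda>a\<in>{..<d}. v a + \<theta> a) + h x (\<lambda>a\<in>{..<d}. u a + \<theta> a)" for \<theta>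
    proof -
      have K: "K \<le> cnt x (\<lambda>a. v a + \<theta> a) + cnt x (\<lambda>a. u a + \<theta> a)"
        unfolding K_def cnt_def sum.distrib[symmetric]
      proof (rule sum_mono)
        fix j
        define A T where "A = dotp d v (Y j x)" and "T = dotp d \<theta> (Y j x)"
        have e: "dotp d (\<lambda>a. v a + \<theta> a) (Y j x) = A + T" "dotp d (\<lambda>a. u a + \<theta> a) (Y j x) = - A + T"
          unfolding A_def T_def u_def by (simp_all add: dotp_add_left dotp_uminus_left dotp_diff_left)
        have "(A + T)\<^sup>2 = A\<^sup>2 + 2 * (A * T) + T\<^sup>2" "(- A + T)\<^sup>2 = A\<^sup>2 - 2 * (A * T) + T\<^sup>2"
          by (simp_all add: power2_eq_square algebra_simps)
        then have "A\<^sup>2 \<le> (A + T)\<^sup>2 \<or> A\<^sup>2 \<le> (- A + T)\<^sup>2"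
          using zero_le_power2[of T] by linarith
        then show "(if r < (dotp d v (Y j x))\<^sup>2 then L else 0)
            \<le> (if r < (dotp d (\<lambda>a. v a + \<theta> a) (Y j x))\<^sup>2 then L else 0)
              + (if r < (dotp d (\<lambda>a. u a + \<theta> a) (Y j x))\<^sup>2 then L else 0)"
          unfolding e A_def[symmetric] using L by auto
      qed
      have c: "real k * exp L * c (\<lambda>a. w a + \<theta> a) \<le> real k * exp L * (quad d S (\<lambda>a. w a + \<theta> a) / r)" for w
        by (intro mult_left_mono c01) auto
      have h: "h x (\<lambda>a\<in>{..<d}. w a + \<theta> a) = cnt x (\<lambda>a. w a + \<theta> a) - real k * exp L * c (\<lambda>a. w a + \<theta> a)" for w
        unfolding h_def cnt_def c_def dotp_restrict quad_restrict ..
      show ?thesis unfolding h distrib_left using K c[of v] c[of u] by linarith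
    qed
    have "K - real k * exp L * ((quad d S v + trace_matr d S / real k) / r + (quad d S u + trace_matr d S / real k) / r)
        = (\<integral>\<theta>. K - real k * exp L * (quad d S (\<lambda>a. v a + \<theta> a) / r + quad d S (\<lambda>a. u a + \<theta> a) / r) \<partial>G)"
    proof -
      have "(\<integral>\<theta>. K - m * (f \<theta> + g \<theta>) \<partial>G) = K - m * ((\<integral>\<theta>. f \<theta> \<partial>G) + (\<integral>\<theta>. g \<theta> \<partial>G))"
        if "integrable G f" "integrable G g" for f g m
        using that by (simp add: G.prob_space)
      from this[OF qint(1) qint(1)] show ?thesis by (simp only: qint(2))
    qed
    also have "\<dots> \<le> (\<integral>\<theta>. h x (\<lambda>a\<in>{..<d}. v a + \<theta> a) + h x (\<lambda>a\<in>{..<d}. u a + \<theta> a) \<partial>G)"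
      by (intro integral_mono pt Bochner_Integration.integrable_diff Bochner_Integration.integrable_add
          integrable_mult_right qint hint) auto
    also have "\<dots> = W v + W u" unfolding W_def by (intro Bochner_Integration.integral_add hint)
    also have "\<dots> \<le> real k + 2 * ln (1 / \<delta>)"
      using shifted[OF x v] shifted[OF x u] by (simp add: W_def)
    finally show ?thesis
      unfolding K_def cnt_eq qu by (simp add: algebra_simps)
  qed
  with E ME show ?thesis by blast
qed

subsection \<open>Bucket means\<close>

definition bilin :: "nat \<Rightarrow> matr \<Rightarrow> vect \<Rightarrow> vect \<Rightarrow> real" where
  "bilin d S u v = (\<Sum>a<d. \<Sum>b<d. u a * S a b * v b)"

lemma quad_eq_bilin: "quad d S v = bilin d S v v"
  by (simp add: quad_def bilin_def)

lemma bilin_eq_dotp: "bilin d S u v = dotp d u (\<lambda>a. \<Sum>b<d. S a b * v b)"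
  by (simp add: bilin_def dotp_def sum_distrib_left mult.assoc)

text \<open>A real supremum says something only about a bounded set. Taking u = Sv in the hypothesis
  bounds the image by \<open>t\<close>; for covariance matrices \<open>t\<close> will be the
  trace.\<close>

lemma op_norm_bounds:
  assumes t: "0 \<le> t" and T: "\<And>u v. bilin d S u v \<le> L2_set u {..<d} * L2_set v {..<d} * t"
  shows "0 \<le> op_norm d S" "op_norm d S \<le> t"
    "\<And>v. L2_set v {..<d} \<le> 1 \<Longrightarrow> quad d S v \<le> op_norm d S"
proof -
  define F where "F = (\<lambda>v. L2_set (\<lambda>a. \<Sum>b<d. S a b * v b) {..<d})"
  define B where "B = {v :: vect. L2_set v {..<d} \<le> 1}"
  have op: "op_norm d S = (SUP v\<in>B. F v)" by (simp add: op_norm_def F_def B_def)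
  have "0 \<le> F v" for v by (simp add: F_def)
  have F_le: "F v \<le> L2_set v {..<d} * t" for v
  proof (cases "F v = 0")
    case False
    define u where "u = (\<lambda>a. \<Sum>b<d. S a b * v b)"
    have "F v * F v = bilin d S u v"
      by (simp add: bilin_eq_dotp u_def[symmetric] F_def L2_set_eq_sqrt_dotp)
    also have "\<dots> \<le> F v * L2_set v {..<d} * t" using T[of u v] by (simp add: F_def u_def)
    finally have "F v * F v \<le> F v * (L2_set v {..<d} * t)" by (simp add: mult.assoc)
    moreover have "0 < F v" using False \<open>0 \<le> F v\<close> by simp
    ultimately show ?thesis by simp
  qed (use t in simp)
  have F_t: "F v \<le> t" if "v \<in> B" for v
  proof -
    have "L2_set v {..<d} * t \<le> 1 * t" using that t by (intro mult_right_mono) (auto simp: B_def)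
    with F_le[of v] show ?thesis by simp
  qed
  then have bdd: "bdd_above (F ` B)" by (rule bdd_aboveI2)
  have zero: "(\<lambda>_. 0) \<in> B" by (simp add: B_def L2_set_def)
  have up: "F v \<le> op_norm d S" if "v \<in> B" for v unfolding op using that bdd by (intro cSUP_upper)
  show "0 \<le> op_norm d S" using up[OF zero] \<open>\<And>v. 0 \<le> F v\<close> order_trans by blast
  show "quad d S v \<le> op_norm d S" if "L2_set v {..<d} \<le> 1" for v
  proof -
    define u where "u = (\<lambda>a. \<Sum>b<d. S a b * v b)"
    have "(quad d S v)\<^sup>2 \<le> dotp d v v * dotp d u u"
      unfolding quad_eq_bilin bilin_eq_dotp u_def by (rule dotp_cauchy_schwarz)
    also have "\<dots> \<le> 1 * dotp d u u"
      using that by (intro mult_right_mono) (auto simp: L2_set_eq_sqrt_dotp)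
    finally have "quad d S v \<le> F v"
      unfolding F_def u_def L2_set_eq_sqrt_dotp by (simp add: real_le_rsqrt)
    also have "\<dots> \<le> op_norm d S" using that by (intro up) (simp add: B_def)
    finally show ?thesis .
  qed
  show "op_norm d S \<le> t"
    unfolding op
  proof (rule cSUP_least)
    show "F v \<le> t" if "v \<in> B" for v by (rule F_t[OF that])
  qed (use zero in blast)
qed


section \<open>Second moments of the sample distribution\<close>

context
  fixes d :: nat and D :: "vect measure"
  assumes D: "finite_cov_distribution d D"
begin

private definition proj :: "vect \<Rightarrow> vect \<Rightarrow> real" where
  "proj u x = dotp d u (\<lambda>a. x a - mean_vec D a)"

lemma prob_space_D: "prob_space D"
  using D by (simp add: finite_cov_distribution_def)

interpretation D: prob_space D by (rule prob_space_D)

lemma coord_measurable: "a < d \<Longrightarrow> (\<lambda>x. x a) \<in> borel_measurable D"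
  using D measurable_component_singleton[of a "{..<d}" "\<lambda>_. borel"]
  by (simp add: finite_cov_distribution_def Rd_def cong: measurable_cong_sets)

lemma coord_integrable: "a < d \<Longrightarrow> integrable D (\<lambda>x. x a)"
  by (rule D.square_integrable_imp_integrable[OF coord_measurable])
    (use D in \<open>simp_all add: finite_cov_distribution_def\<close>)

lemma centered_integrable:
  "a < d \<Longrightarrow> integrable D (\<lambda>x. x a - mean_vec D a)"
  "a < d \<Longrightarrow> integrable D (\<lambda>x. (x a - mean_vec D a)\<^sup>2)"
proof -
  assume a: "a < d"
  show "integrable D (\<lambda>x. x a - mean_vec D a)"
    using coord_integrable[OF a] by simp
  have "integrable D (\<lambda>x. (x a)\<^sup>2)" using D a by (simp add: finite_cov_distribution_def)
  then show "integrable D (\<lambda>x. (x a - mean_vec D a)\<^sup>2)"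
    using coord_integrable[OF a] by (simp add: power2_diff)
qed

lemma cov_integrable:
  assumes "a < d" "b < d"
  shows "integrable D (\<lambda>x. (x a - mean_vec D a) * (x b - mean_vec D b))"
proof (rule Bochner_Integration.integrable_bound)
  show "integrable D (\<lambda>x. (x a - mean_vec D a)\<^sup>2 + (x b - mean_vec D b)\<^sup>2)"
    using assms centered_integrable by (intro Bochner_Integration.integrable_add) auto
  show "(\<lambda>x. (x a - mean_vec D a) * (x b - mean_vec D b)) \<in> borel_measurable D"
    using assms coord_measurable by measurable
  have "\<bar>p * q\<bar> \<le> p\<^sup>2 + q\<^sup>2" for p q :: real
  proof -
    have "(\<bar>p\<bar> - \<bar>q\<bar>)\<^sup>2 = p\<^sup>2 - 2 * \<bar>p * q\<bar> + q\<^sup>2" by (simp add: power2_diff abs_mult)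
    then show ?thesis using zero_le_power2[of "\<bar>p\<bar> - \<bar>q\<bar>"] abs_ge_zero[of "p * q"] by linarith
  qed
  then show "AE x in D. norm ((x a - mean_vec D a) * (x b - mean_vec D b))
      \<le> norm ((x a - mean_vec D a)\<^sup>2 + (x b - mean_vec D b)\<^sup>2)"
    by simp
qed

lemma proj_integrable: "integrable D (proj u)" and proj_mean: "(\<integral>x. proj u x \<partial>D) = 0"
proof -
  have i: "integrable D (\<lambda>x. u a * (x a - mean_vec D a))" if "a \<in> {..<d}" for a
    using that centered_integrable(1) by auto
  show "integrable D (proj u)"
    unfolding proj_def[abs_def] dotp_def using i by (rule Bochner_Integration.integrable_sum)
  have "(\<integral>x. proj u x \<partial>D) = (\<Sum>a<d. \<integral>x. u a * (x a - mean_vec D a) \<partial>D)"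
    unfolding proj_def dotp_def using i by (rule Bochner_Integration.integral_sum)
  also have "\<dots> = 0"
    using coord_integrable by (intro sum.neutral) (auto simp: mean_vec_def D.prob_space)
  finally show "(\<integral>x. proj u x \<partial>D) = 0" .
qed

lemma proj_mult:
  shows "integrable D (\<lambda>x. proj u x * proj v x)"
    and "(\<integral>x. proj u x * proj v x \<partial>D) = bilin d (cov_matr D) u v"
proof -
  have eq: "proj u x * proj v x =
      (\<Sum>a<d. \<Sum>b<d. (u a * v b) * ((x a - mean_vec D a) * (x b - mean_vec D b)))" for x
    unfolding proj_def dotp_def sum_product by (simp add: mult_ac)
  have i: "integrable D (\<lambda>x. (u a * v b) * ((x a - mean_vec D a) * (x b - mean_vec D b)))"
    if "a \<in> {..<d}" "b \<in> {..<d}" for a b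
    using that by (intro integrable_mult_right cov_integrable) auto
  show "integrable D (\<lambda>x. proj u x * proj v x)"
    unfolding eq using i by (intro Bochner_Integration.integrable_sum)
  have "(\<integral>x. proj u x * proj v x \<partial>D) =
      (\<Sum>a<d. \<Sum>b<d. \<integral>x. (u a * v b) * ((x a - mean_vec D a) * (x b - mean_vec D b)) \<partial>D)"
    unfolding eq
    by (subst Bochner_Integration.integral_sum, intro Bochner_Integration.integrable_sum i, assumption+)
      (intro sum.cong refl Bochner_Integration.integral_sum i)
  then show "(\<integral>x. proj u x * proj v x \<partial>D) = bilin d (cov_matr D) u v"
    by (simp add: bilin_def cov_matr_def mult_ac)
qed

lemma trace_cov:
  "integrable D (\<lambda>x. dotp d (\<lambda>a. x a - mean_vec D a) (\<lambda>a. x a - mean_vec D a))"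
  "(\<integral>x. dotp d (\<lambda>a. x a - mean_vec D a) (\<lambda>a. x a - mean_vec D a) \<partial>D) = trace_matr d (cov_matr D)"
  unfolding dotp_def trace_matr_def cov_matr_def
  by (auto intro!: Bochner_Integration.integrable_sum Bochner_Integration.integral_sum cov_integrable)

lemma trace_cov_nonneg: "0 \<le> trace_matr d (cov_matr D)"
  unfolding trace_cov(2)[symmetric] by (rule Bochner_Integration.integral_nonneg) simp

text \<open>Cauchy-Schwarz in the integrand, twice, leaves the squared norm of the centred sample,
  whose mean is the trace.\<close>

lemma bilin_cov_le:
  "bilin d (cov_matr D) u v \<le> L2_set u {..<d} * L2_set v {..<d} * trace_matr d (cov_matr D)"
proof -
  have "bilin d (cov_matr D) u v \<le> (\<integral>x. L2_set u {..<d} * L2_set v {..<d} *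
      dotp d (\<lambda>a. x a - mean_vec D a) (\<lambda>a. x a - mean_vec D a) \<partial>D)"
    unfolding proj_mult(2)[symmetric]
  proof (rule integral_mono)
    fix x
    define y where "y = (\<lambda>a. x a - mean_vec D a)"
    have *: "\<bar>dotp d w y\<bar> \<le> sqrt (dotp d w w) * sqrt (dotp d y y)" for w
      using real_sqrt_le_mono[OF dotp_cauchy_schwarz[of d w y]] by (simp add: real_sqrt_mult)
    have "proj u x * proj v x \<le> \<bar>dotp d u y\<bar> * \<bar>dotp d v y\<bar>"
      by (simp add: proj_def y_def abs_mult[symmetric])
    also have "\<dots> \<le> (sqrt (dotp d u u) * sqrt (dotp d y y)) * (sqrt (dotp d v v) * sqrt (dotp d y y))"
      by (intro mult_mono *) auto
    also have "\<dots> = sqrt (dotp d u u) * sqrt (dotp d v v) * (sqrt (dotp d y y) * sqrt (dotp d y y))"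
      by (simp only: mult_ac)
    also have "\<dots> = L2_set u {..<d} * L2_set v {..<d} * dotp d y y"
      by (simp add: L2_set_eq_sqrt_dotp)
    finally show "proj u x * proj v x \<le> L2_set u {..<d} * L2_set v {..<d} *
      dotp d (\<lambda>a. x a - mean_vec D a) (\<lambda>a. x a - mean_vec D a)" by (simp add: y_def)
  qed (use proj_mult(1) trace_cov(1) in auto)
  also have "\<dots> = L2_set u {..<d} * L2_set v {..<d} * trace_matr d (cov_matr D)"
    by (simp add: trace_cov(2))
  finally show ?thesis .
qed

lemmas op_norm_cov = op_norm_bounds[OF trace_cov_nonneg bilin_cov_le]

lemma quad_cov_nonneg: "0 \<le> quad d (cov_matr D) u"
  unfolding quad_eq_bilin proj_mult(2)[symmetric] by (rule Bochner_Integration.integral_nonneg) simp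

lemma quad_cov_le: "quad d (cov_matr D) u \<le> dotp d u u * trace_matr d (cov_matr D)"
  using bilin_cov_le[of u u] by (simp add: quad_eq_bilin L2_set_eq_sqrt_dotp)

section \<open>Independence and tails of the bucket deviations\<close>

lemma indep_vars_coordinates:
  assumes "0 < n"
  shows "prob_space.indep_vars (PiM {..<n} (\<lambda>_. D)) (\<lambda>_. D) (\<lambda>i X. X i) {..<n}"
proof -
  interpret P: prob_space "PiM {..<n} (\<lambda>_. D)" by (intro prob_space_PiM prob_space_D)
  have "distr (PiM {..<n} (\<lambda>_. D)) (PiM {..<n} (\<lambda>_. D)) (\<lambda>x. \<lambda>i\<in>{..<n}. x i) =
      distr (PiM {..<n} (\<lambda>_. D)) (PiM {..<n} (\<lambda>_. D)) (\<lambda>x. x)"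
    by (intro distr_cong) (auto simp: space_PiM PiE_def extensional_restrict)
  also have "\<dots> = PiM {..<n} (\<lambda>_. D)" by (rule distr_id2) simp
  also have "\<dots> = PiM {..<n} (\<lambda>i. distr (PiM {..<n} (\<lambda>_. D)) D (\<lambda>x. x i))"
    using prob_space_D by (intro PiM_cong distr_PiM_component[symmetric]) auto
  finally show ?thesis
    using assms by (subst P.indep_vars_iff_distr_eq_PiM') auto
qed

private definition dev :: "nat \<Rightarrow> nat \<Rightarrow> nat \<Rightarrow> (nat \<Rightarrow> vect) \<Rightarrow> vect" where
  "dev n k j X = (\<lambda>a. bucket_means n k X j a - mean_vec D a)"

private definition block :: "nat \<Rightarrow> nat \<Rightarrow> nat \<Rightarrow> nat set" where
  "block n k j = {j * (n div k)..<(j + 1) * (n div k)}"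

lemma block_subset: "j < k \<Longrightarrow> block n k j \<subseteq> {..<n}"
proof -
  assume "j < k"
  then have "(j + 1) * (n div k) \<le> k * (n div k)" by (intro mult_right_mono) auto
  also have "\<dots> \<le> n" by simp
  finally show ?thesis by (auto simp: block_def)
qed

lemma block_card: "card (block n k j) = n div k"
  by (simp add: block_def)

lemma block_disjoint: "disjoint_family_on (block n k) J"
proof -
  have "i \<notin> block n k j'" if "i \<in> block n k j" "j \<noteq> j'" for i j j'
  proof
    assume "i \<in> block n k j'"
    with that(1) have "i div (n div k) = j" "i div (n div k) = j'"
      by (auto simp: block_def intro!: div_nat_eqI simp: mult.commute)
    with that(2) show False by simp
  qed
  then show ?thesis by (auto simp: disjoint_family_on_def)
qed

lemma dotp_dev:
  assumes "0 < n div k"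
  shows "dotp d u (dev n k j X) = (\<Sum>i\<in>block n k j. proj u (X i)) / real (n div k)"
proof -
  have "(\<Sum>i\<in>block n k j. proj u (X i)) = (\<Sum>a<d. \<Sum>i\<in>block n k j. u a * (X i a - mean_vec D a))"
    unfolding proj_def dotp_def by (rule sum.swap)
  also have "\<dots> = (\<Sum>a<d. real (n div k) * (u a * dev n k j X a))"
  proof (rule sum.cong[OF refl])
    fix a
    have "(\<Sum>i\<in>block n k j. u a * (X i a - mean_vec D a)) =
        u a * ((\<Sum>i\<in>block n k j. X i a) - real (n div k) * mean_vec D a)"
      by (simp add: sum_distrib_left[symmetric] sum_subtractf block_card)
    also have "\<dots> = real (n div k) * (u a * ((\<Sum>i\<in>block n k j. X i a) / real (n div k) - mean_vec D a))"
    proof -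
      have "w * (z - b * m) = b * (w * (z / b - m))" if "0 < b" for w z b m :: real
        using that by (simp add: field_simps)
      then show ?thesis using assms by simp
    qed
    finally show "(\<Sum>i\<in>block n k j. u a * (X i a - mean_vec D a)) = real (n div k) * (u a * dev n k j X a)"
      by (simp only: dev_def bucket_means_def block_def)
  qed
  finally show ?thesis using assms by (simp add: dotp_def sum_distrib_left[symmetric])
qed

lemma proj_measurable: "proj u \<in> borel_measurable D"
  using proj_integrable by auto

lemma bucket_indep:
  assumes "0 < n div k" "0 < n"
  shows "prob_space.indep_vars (PiM {..<n} (\<lambda>_. D)) (\<lambda>_. borel) (\<lambda>j X. dotp d u (dev n k j X)) {..<k}"
proof -
  interpret P: prob_space "PiM {..<n} (\<lambda>_. D)" by (intro prob_space_PiM prob_space_D)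
  have "P.indep_vars (\<lambda>j. PiM (block n k j) (\<lambda>_. D)) (\<lambda>j X. restrict X (block n k j)) {..<k}"
    using P.indep_vars_restrict[OF indep_vars_coordinates[OF assms(2)], of "{..<k}" "block n k"]
      block_subset block_disjoint by simp
  moreover have "(\<lambda>x. (\<Sum>i\<in>block n k j. proj u (x i)) / real (n div k)) \<in> borel_measurable (PiM (block n k j) (\<lambda>_. D))" for j
    by (intro borel_measurable_divide borel_measurable_sum borel_measurable_const
        measurable_compose[OF _ proj_measurable] measurable_component_singleton)
  ultimately have "P.indep_vars (\<lambda>_. borel)
      (\<lambda>j X. (\<Sum>i\<in>block n k j. proj u (restrict X (block n k j) i)) / real (n div k)) {..<k}"
    by (rule P.indep_vars_compose2)
  then show ?thesis by (simp add: dotp_dev[OF assms(1)])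
qed

text \<open>Distinct samples contribute products of zero means, so only the n div k diagonal terms
  survive, against the square of n div k in the denominator.\<close>

lemma dev_second_moment:
  assumes "0 < n div k" "j < k"
  shows "integrable (PiM {..<n} (\<lambda>_. D)) (\<lambda>X. (dotp d u (dev n k j X))\<^sup>2)"
    "(\<integral>X. (dotp d u (dev n k j X))\<^sup>2 \<partial>PiM {..<n} (\<lambda>_. D)) = quad d (cov_matr D) u / real (n div k)"
proof -
  define B where "B = block n k j"
  have B: "B \<subseteq> {..<n}" "finite B" "card B = n div k"
    using block_subset[OF assms(2)] by (auto simp: B_def block_card) (simp add: block_def)
  have eq: "(dotp d u (dev n k j X))\<^sup>2 = (\<Sum>i\<in>B. \<Sum>l\<in>B. proj u (X i) * proj u (X l)) / (real (n div k))\<^sup>2" for X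
    unfolding dotp_dev[OF assms(1)] B_def[symmetric] by (simp add: power_divide power2_eq_square sum_product)
  have i: "integrable (PiM {..<n} (\<lambda>_. D)) (\<lambda>X. proj u (X i) * proj u (X l))"
    and I: "(\<integral>X. proj u (X i) * proj u (X l) \<partial>PiM {..<n} (\<lambda>_. D)) = (if i = l then quad d (cov_matr D) u else 0)"
    if "i \<in> B" "l \<in> B" for i l
  proof -
    have "i \<in> {..<n}" "l \<in> {..<n}" using that B by auto
    from product_second_moments(3,4)[OF prob_space_D this finite_lessThan proj_integrable proj_mult(1), of u]
    show "integrable (PiM {..<n} (\<lambda>_. D)) (\<lambda>X. proj u (X i) * proj u (X l))"
      "(\<integral>X. proj u (X i) * proj u (X l) \<partial>PiM {..<n} (\<lambda>_. D)) = (if i = l then quad d (cov_matr D) u else 0)"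
      by (simp_all add: proj_mean proj_mult(2) quad_eq_bilin)
  qed
  show "integrable (PiM {..<n} (\<lambda>_. D)) (\<lambda>X. (dotp d u (dev n k j X))\<^sup>2)"
    unfolding eq using i by (intro integrable_divide_zero Bochner_Integration.integrable_sum) auto
  have "(\<integral>X. (\<Sum>i\<in>B. \<Sum>l\<in>B. proj u (X i) * proj u (X l)) \<partial>PiM {..<n} (\<lambda>_. D)) =
      (\<Sum>i\<in>B. \<Sum>l\<in>B. if i = l then quad d (cov_matr D) u else 0)"
    by (subst Bochner_Integration.integral_sum, intro Bochner_Integration.integrable_sum i, assumption+)
      (intro sum.cong refl, subst Bochner_Integration.integral_sum, auto intro: i intro!: sum.cong I)
  also have "\<dots> = real (n div k) * quad d (cov_matr D) u"
    using B by simp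
  finally show "(\<integral>X. (dotp d u (dev n k j X))\<^sup>2 \<partial>PiM {..<n} (\<lambda>_. D)) = quad d (cov_matr D) u / real (n div k)"
    unfolding eq using assms(1) by (simp add: power2_eq_square)
qed

text \<open>Chebyshev's inequality. For r = 0 the right-hand side is 0 by the convention for
  division, so the event must be null; vanishing variance supplies that.\<close>

lemma dev_tail:
  assumes "0 < n div k" "j < k" "0 \<le> r" and r0: "r = 0 \<Longrightarrow> quad d (cov_matr D) u = 0"
  shows "measure (PiM {..<n} (\<lambda>_. D)) {X \<in> space (PiM {..<n} (\<lambda>_. D)). r < (dotp d u (dev n k j X))\<^sup>2}
    \<le> quad d (cov_matr D) u / real (n div k) / r"
proof -
  let ?P = "PiM {..<n} (\<lambda>_. D)" and ?T = "\<lambda>X. (dotp d u (dev n k j X))\<^sup>2"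
  interpret P: prob_space ?P by (intro prob_space_PiM prob_space_D)
  note mom = dev_second_moment[OF assms(1,2), of u]
  have [measurable]: "?T \<in> borel_measurable ?P" using mom(1) by auto
  show ?thesis
  proof (cases "r = 0")
    case True
    have "(\<integral>X. ?T X \<partial>?P) = 0" using r0[OF True] by (simp add: mom(2))
    then have "AE X in ?P. ?T X = 0"
      using integral_nonneg_eq_0_iff_AE[OF mom(1)] by simp
    then have "AE X in ?P. X \<notin> {X \<in> space ?P. r < ?T X}" using True by (auto elim!: eventually_mono)
    then have "measure ?P {X \<in> space ?P. r < ?T X} = 0"
      by (intro P.prob_eq_0[THEN iffD2]) auto
    then show ?thesis using True by simp
  next
    case False
    then have r: "0 < r" using assms(3) by simp
    have "measure ?P {X \<in> space ?P. r < ?T X} \<le> measure ?P {X \<in> space ?P. r \<le> ?T X}"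
      by (intro P.finite_measure_mono) auto
    also have "\<dots> \<le> (\<integral>X. ?T X \<partial>?P) / r"
      using mom(1) r by (intro integral_Markov_inequality_measure[where A = "{}"]) auto
    finally show ?thesis by (simp add: mom(2))
  qed
qed

text \<open>The exponent L = 128/\<epsilon> is fixed first, and \<open>r\<close> is then taken large
  enough to outweigh exp L. The count bound totals at most 4k: k from the entropy, at most k/400
  from ln(1/\<delta>), and at most 2k from the tails. Division by L leaves the \<epsilon>k/32
  exceptions that the rounding tolerates.\<close>

lemma bucket_spectral_center:
  assumes eps: "0 < \<epsilon>" "\<epsilon> < 1" and \<delta>: "0 < \<delta>" and k: "0 < k" "k \<le> n" "800 * ln (1 / \<delta>) \<le> real k"
    and r_def: "r = 2 * exp (128 / \<epsilon>) * (op_norm d (cov_matr D) * real k / real n + trace_matr d (cov_matr D) / real n)"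
  shows "\<exists>E\<in>sets (PiM {..<n} (\<lambda>_. D)). 1 - \<delta> \<le> measure (PiM {..<n} (\<lambda>_. D)) E \<and>
    (\<forall>X\<in>E. \<exists>w. spectral_center d k (bucket_means n k X) \<epsilon> (64 * r) w (mean_vec D))"
proof -
  define P where "P = PiM {..<n} (\<lambda>_. D)"
  interpret P: prob_space P unfolding P_def by (intro prob_space_PiM prob_space_D)
  define b where "b = n div k"
  have n0: "0 < n" using k by simp
  have b0: "0 < b" using k by (simp add: b_def div_greater_zero_iff)
  \<comment> \<open>Rounding n/k down loses at most a factor 2, because k \<le> n makes
    \<open>b\<close> at least 1.\<close>
  have nb: "real n \<le> 2 * real k * real b"
  proof -
    have "n = k * b + n mod k" by (simp add: b_def)
    also have "\<dots> \<le> k * b + k * b" using b0 k(1) mod_less_divisor[OF k(1), of n]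
      by (intro add_left_mono) (metis Suc_leI less_imp_le mult.right_neutral mult_le_mono2 order_trans One_nat_def)
    finally have "real n \<le> real (k * b + k * b)" by (rule of_nat_mono)
    then show ?thesis by (simp add: mult_ac)
  qed
  define L where "L = 128 / \<epsilon>"
  define op where "op = op_norm d (cov_matr D)"
  define t where "t = trace_matr d (cov_matr D)"
  have op: "0 \<le> op" and t: "0 \<le> t" using op_norm_cov(1) trace_cov_nonneg by (auto simp: op_def t_def)
  define q where "q = op * real k / real n + t / real n"
  have q: "0 \<le> q" using op t by (simp add: q_def)
  have r: "r = 2 * exp L * q" "0 \<le> r" using q by (simp_all add: r_def q_def L_def op_def t_def)
  \<comment> \<open>The radius vanishes only if the trace does, that is, only if the distribution
    has no variance in any direction.\<close>
  have r0: "quad d (cov_matr D) u = 0" if "r = 0" for u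
  proof -
    have "q = 0" using that by (simp add: r)
    moreover have "0 \<le> op * real k / real n" "0 \<le> t / real n" using op t by auto
    ultimately have "t / real n = 0" unfolding q_def by linarith
    then have "t = 0" using n0 by simp
    then show ?thesis using quad_cov_le[of u] quad_cov_nonneg[of u] by (simp add: t_def)
  qed
  define S where "S = (\<lambda>i j. cov_matr D i j / real b)"
  have quadS: "quad d S u = quad d (cov_matr D) u / real b" for u
    by (simp add: S_def quad_def sum_divide_distrib)
  have traceS: "trace_matr d S = t / real b"
    by (simp add: S_def t_def trace_matr_def sum_divide_distrib)
  have "\<exists>E\<in>sets P. 1 - \<delta> \<le> measure P E \<and>
    (\<forall>X\<in>E. \<forall>v. dotp d v v \<le> 1 \<longrightarrow>
      L * real (card {j. j < k \<and> r < (dotp d v (dev n k j X))\<^sup>2})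
        \<le> real k + 2 * ln (1 / \<delta>) + 2 * real k * exp L * ((quad d S v + trace_matr d S / real k) / r))"
  proof (rule uniform_direction_count[OF P.prob_space_axioms k(1) _ r(2) \<delta>])
    show "0 \<le> L" using eps by (simp add: L_def)
    show "(\<lambda>X. dev n k j X a) \<in> borel_measurable P" if "j < k" "a < d" for j a
    proof -
      have "(\<lambda>X. X i a) \<in> borel_measurable P" if "i \<in> block n k j" for i
        using that block_subset[OF \<open>j < k\<close>] unfolding P_def
        by (intro measurable_compose[OF _ coord_measurable[OF \<open>a < d\<close>]] measurable_component_singleton) auto
      then have "(\<lambda>X. \<Sum>i\<in>block n k j. X i a) \<in> borel_measurable P" by (rule borel_measurable_sum)
      then show ?thesis unfolding dev_def bucket_means_def block_def by measurable
    qed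
    show "P.indep_vars (\<lambda>_. borel) (\<lambda>j X. dotp d \<theta> (dev n k j X)) {..<k}" for \<theta>
      unfolding P_def using b0 n0 by (intro bucket_indep) (auto simp: b_def)
    show "measure P {X \<in> space P. r < (dotp d \<theta> (dev n k j X))\<^sup>2} \<le> quad d S \<theta> / r" if "j < k" for \<theta> j
      unfolding P_def quadS b_def using b0 that r(2) r0 by (intro dev_tail) (auto simp: b_def)
  qed
  then obtain E where E: "E \<in> sets P" "1 - \<delta> \<le> measure P E"
    and cnt: "\<And>X v. X \<in> E \<Longrightarrow> dotp d v v \<le> 1 \<Longrightarrow>
      L * real (card {j. j < k \<and> r < (dotp d v (dev n k j X))\<^sup>2})
        \<le> real k + 2 * ln (1 / \<delta>) + 2 * real k * exp L * ((quad d S v + trace_matr d S / real k) / r)"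
    by blast
  have "\<exists>w. spectral_center d k (bucket_means n k X) \<epsilon> (64 * r) w (mean_vec D)" if X: "X \<in> E" for X
  proof -
    have "real (card {j. j < k \<and> r < (dotp d v (dev n k j X))\<^sup>2}) \<le> \<epsilon> / 32 * real k" if v: "dotp d v v \<le> 1" for v
    proof -
      have "quad d S v + trace_matr d S / real k \<le> (op + t / real k) / real b"
        using op_norm_cov(3)[of v] v b0
        by (simp add: quadS traceS add_divide_distrib L2_set_eq_sqrt_dotp op_def divide_right_mono mult.commute)
      also have "\<dots> = (op + t / real k) * (1 / real b)" by simp
      also have "\<dots> \<le> (op + t / real k) * (2 * real k / real n)"
        using nb b0 n0 op t by (intro mult_left_mono) (auto simp: field_simps)
      also have "\<dots> = 2 * q" using k n0 by (simp add: q_def field_simps)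
      finally have le: "quad d S v + trace_matr d S / real k \<le> 2 * q" .
      have "2 * real k * exp L * ((quad d S v + trace_matr d S / real k) / r) \<le> 2 * real k"
      proof (cases "r = 0")
        case False
        then have q0: "0 < q" using q by (auto simp: r(1) less_le)
        have "(quad d S v + trace_matr d S / real k) / r \<le> 2 * q / r"
          using le r(2) by (rule divide_right_mono)
        also have "\<dots> = 1 / exp L" using q0 by (simp add: r(1))
        finally have "2 * real k * exp L * ((quad d S v + trace_matr d S / real k) / r) \<le> 2 * real k * exp L * (1 / exp L)"
          by (intro mult_left_mono) auto
        then show ?thesis by simp
      qed simp
      with cnt[OF X v] k(3) have "L * real (card {j. j < k \<and> r < (dotp d v (dev n k j X))\<^sup>2}) \<le> 4 * real k"
        by linarith
      then show ?thesis using eps by (simp add: L_def field_simps)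
    qed
    from reweighing_exists[OF k(1) eps r(2) this]
    show ?thesis unfolding spectral_center_iff dev_def by blast
  qed
  with E show ?thesis unfolding P_def by blast
qed

end

section \<open>Assembly of the error bound\<close>

theorem theorem6p4:
  fixes \<epsilon> \<alpha> :: real
  assumes "0 < \<epsilon>" and "\<epsilon> < 1 / 4" and "1 \<le> \<alpha>"
  shows "\<exists>C>0. \<forall>(A :: reweighing_algorithm) (d :: nat) (n :: nat) (\<delta> :: real) (D :: vect measure).
    solves_spectral_reweighing \<alpha> \<epsilon> A \<longrightarrow>
    finite_cov_distribution d D \<longrightarrow>
    2 powr (- (real n / (800 * ln 2))) \<le> \<delta> \<longrightarrow> \<delta> < 1 \<longrightarrow>
    (\<exists>E \<in> sets (PiM {..<n} (\<lambda>_. D)).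
       measure (PiM {..<n} (\<lambda>_. D)) E \<ge> 1 - \<delta> \<and>
       (\<forall>X\<in>E. L2_set (\<lambda>a. mean_estimate \<alpha> \<epsilon> A d n \<delta> X a - mean_vec D a) {..<d}
          \<le> C * (sqrt (trace_matr d (cov_matr D) / real n)
                + sqrt (op_norm d (cov_matr D) * ln (1 / \<delta>) / real n))))"
proof -
  \<comment> \<open>The squared constant collects 2 + 4\<alpha> from the search, 64 from sign
    rounding, 2 exp(128/\<epsilon>) from the radius, 800 from the bucket count, and the common mass
    1 - 4\<epsilon> of two centres.\<close>
  define C2 where "C2 = (2 + 4 * \<alpha>) * (64 * (2 * exp (128 / \<epsilon>) * 800)) / (1 - 4 * \<epsilon>)"
  have C2: "0 < C2" using assms by (simp add: C2_def)
  have main: "\<exists>E \<in> sets (PiM {..<n} (\<lambda>_. D)).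
       measure (PiM {..<n} (\<lambda>_. D)) E \<ge> 1 - \<delta> \<and>
       (\<forall>X\<in>E. L2_set (\<lambda>a. mean_estimate \<alpha> \<epsilon> A d n \<delta> X a - mean_vec D a) {..<d}
          \<le> sqrt C2 * (sqrt (trace_matr d (cov_matr D) / real n)
                + sqrt (op_norm d (cov_matr D) * ln (1 / \<delta>) / real n)))"
    if A: "solves_spectral_reweighing \<alpha> \<epsilon> A" and D: "finite_cov_distribution d D"
      and dl: "2 powr (- (real n / (800 * ln 2))) \<le> \<delta>" and d1: "\<delta> < 1" for A d n \<delta> D
  proof -
    \<comment> \<open>The lower bound on \<delta> is exactly what keeps 800 ln(1/\<delta>) at most
      n. As n is an integer, rounding up preserves this, and no bucket is empty.\<close>
    have dn: "exp (- (real n / 800)) \<le> \<delta>" using dl by (simp add: powr_def)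
    have d0: "0 < \<delta>" using dn by (meson exp_gt_zero order_less_le_trans)
    define l where "l = ln (1 / \<delta>)"
    have l0: "0 < l" using d0 d1 by (simp add: l_def)
    have "- (real n / 800) \<le> ln \<delta>" using dn d0 by (simp add: ln_ge_iff)
    then have ln: "800 * l \<le> real n" using d0 by (simp add: l_def ln_div)
    define k where "k = bucket_count \<delta>"
    have kl: "800 * l \<le> real k" "real k \<le> 800 * l + 1"
      using l0 unfolding k_def bucket_count_def l_def[symmetric] by linarith+
    have k0: "0 < k" using kl(1) l0 by (cases k) auto
    have kn: "k \<le> n"
      unfolding k_def bucket_count_def l_def[symmetric] using ln by (simp add: ceiling_le_iff nat_le_iff)
    have n0: "0 < n" using k0 kn by simp
    define op where "op = op_norm d (cov_matr D)"
    define t where "t = trace_matr d (cov_matr D)"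
    have op: "0 \<le> op" "op \<le> t" using op_norm_cov(1,2)[OF D] by (auto simp: op_def t_def)
    define q where "q = op * real k / real n + t / real n"
    \<comment> \<open>For \<delta> near 1 the logarithm cannot absorb the 1 lost by rounding up; the
      trace does, since the operator norm is at most the trace.\<close>
    have "op * real k + t \<le> op * (800 * l + 1) + t"
      using kl(2) op by (intro add_right_mono mult_left_mono) auto
    also have "\<dots> \<le> 800 * (t + op * l)" using op by (simp add: algebra_simps)
    finally have "(op * real k + t) / real n \<le> 800 * (t + op * l) / real n"
      by (rule divide_right_mono) simp
    then have q: "q \<le> 800 * (t / real n + op * l / real n)"
      by (simp add: q_def add_divide_distrib algebra_simps)
    define r where "r = 2 * exp (128 / \<epsilon>) * q"
    have r0: "0 \<le> r" using op by (simp add: r_def q_def)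
    obtain E where E: "E \<in> sets (PiM {..<n} (\<lambda>_. D))" "1 - \<delta> \<le> measure (PiM {..<n} (\<lambda>_. D)) E"
      and cen: "\<And>X. X \<in> E \<Longrightarrow> \<exists>w. spectral_center d k (bucket_means n k X) \<epsilon> (64 * r) w (mean_vec D)"
      using bucket_spectral_center[OF D, of \<epsilon> \<delta> k n r] assms d0 k0 kn kl(1)
      by (auto simp: r_def q_def op_def t_def l_def)
    have "L2_set (\<lambda>a. mean_estimate \<alpha> \<epsilon> A d n \<delta> X a - mean_vec D a) {..<d}
        \<le> sqrt C2 * (sqrt (t / real n) + sqrt (op * l / real n))" if X: "X \<in> E" for X
    proof -
      define N where "N = L2_set (\<lambda>a. mean_estimate \<alpha> \<epsilon> A d n \<delta> X a - mean_vec D a) {..<d}"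
      define z where "z = t / real n + op * l / real n"
      obtain w where w: "spectral_center d k (bucket_means n k X) \<epsilon> (64 * r) w (mean_vec D)"
        using cen[OF X] by blast
      have "(1 - 4 * \<epsilon>) * N\<^sup>2 \<le> (2 + 4 * \<alpha>) * (64 * r)"
        using searched_center_close[OF assms k0 A w] r0 by (simp add: N_def mean_estimate_def k_def)
      also have "\<dots> \<le> (2 + 4 * \<alpha>) * (64 * (2 * exp (128 / \<epsilon>) * (800 * z)))"
        using q assms unfolding r_def z_def by (intro mult_left_mono) auto
      finally have "N\<^sup>2 \<le> C2 * z"
        using assms by (simp add: C2_def pos_le_divide_eq mult_ac)
      then have "N \<le> sqrt (C2 * z)" by (rule real_le_rsqrt)
      also have "\<dots> = sqrt C2 * sqrt z" by (rule real_sqrt_mult)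
      also have "\<dots> \<le> sqrt C2 * (sqrt (t / real n) + sqrt (op * l / real n))"
        unfolding z_def using C2 op l0
        by (intro mult_left_mono sqrt_add_le_add_sqrt) auto
      finally show ?thesis by (simp add: N_def)
    qed
    with E show ?thesis unfolding op_def t_def l_def by blast
  qed
  show ?thesis
    by (rule exI[of _ "sqrt C2"]) (use main C2 in auto)
qed

end
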